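(* Let $E$ be a finite-dimensional complex Hilbert space and let $M:[0,2\pi]\to\mathcal L(E)$ be a $C^1$ periodic loop having a point gap at $z_\ast\in\mathbb C$, i.e. $M(t)-z_\ast I_E$ is invertible for every $t$. Set $$A_{z_\ast}(t):=M(t)-z_\ast I_E,\qquad \mathcal Q_{z_\ast}(t):=A_{z_\ast}(t)\bigl(A_{z_\ast}(t)^\dagger A_{z_\ast}(t)\bigr)^{-1/2}.$$ Then $\mathcal Q_{z_\ast}$ is the unitary polar factor of $A_{z_\ast}$ and is a $C^1$ periodic loop. The family $$\mathbb H_{z_\ast}(t):=\begin{pmatrix}0&A_{z_\ast}(t)\\ A_{z_\ast}(t)^\dagger&0\end{pmatrix}$$ on $E\oplus E$ has a uniform spectral gap about zero, and its family of negative spectral subspaces has the periodic orthonormal frame $$\Psi_-(t):=\frac1{\sqrt2}\begin{pmatrix}-\mathcal Q_{z_\ast}(t)\\ I_E\end{pmatrix}.$$ The winding of the polar unitary is the determinant point-gap winding: $$\frac1{2\pi i}\int_0^{2\pi}\operatorname{tr}_E\bigl(\mathcal Q_{z_\ast}(t)^\dagger\partial_t\mathcal Q_{z_\ast}(t)\bigr)\,dt=W(M;z_\ast).$$ The Zak phase of the negative spectral subspace satisfies $$\gamma_{\mathrm{Herm}}(z_\ast):=i\int_0^{2\pi}\operatorname{tr}_E\bigl(\Psi_-(t)^\dagger\partial_t\Psi_-(t)\bigr)\,dt=-\pi W(M;z_\ast)\equiv\pi W(M;z_\ast)\pmod{2\pi}.$$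
   Context: ${}^\dagger$ is the Hilbert adjoint. A $C^1$ periodic loop is a map on $[0,2\pi]$ extending to a $2\pi$-periodic $C^1$ map on $\mathbb R$. $W(M;z_\ast)\in\mathbb Z$ is the determinant winding: the winding number about $0$ (as $t$ increases from $0$ to $2\pi$) of the nonvanishing closed loop $t\mapsto\det_E(M(t)-z_\ast I_E)$. $\Psi_-(t)$ is viewed as a map $E\to E\oplus E$; being an orthonormal frame means $\Psi_-(t)^\dagger\Psi_-(t)=I_E$ and that its range is the negative spectral subspace of $\mathbb H_{z_\ast}(t)$. A uniform spectral gap about zero means that there is $m>0$ with $\sigma(\mathbb H_{z_\ast}(t))\cap(-m,m)=\emptyset$ for all $t$. *)

theory Defs
  imports
    "HOL-Complex_Analysis.Complex_Analysis"
    "Jordan_Normal_Form.Determinant"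
begin

section \<open>Finite-dimensional complex Hilbert spaces\<close>

class complex_vector = real_vector +
  fixes scaleC :: "complex \<Rightarrow> 'a \<Rightarrow> 'a"  (infixr \<open>*\<^sub>C\<close> 75)
  assumes scaleC_add_right: "c *\<^sub>C (x + y) = c *\<^sub>C x + c *\<^sub>C y"
    and scaleC_add_left: "(c + d) *\<^sub>C x = c *\<^sub>C x + d *\<^sub>C x"
    and scaleC_scaleC: "c *\<^sub>C (d *\<^sub>C x) = (c * d) *\<^sub>C x"
    and scaleC_one: "1 *\<^sub>C x = x"
    and scaleR_eq_scaleC: "r *\<^sub>R x = complex_of_real r *\<^sub>C x"

global_interpretation complex_vector: vector_space "scaleC :: complex \<Rightarrow> 'a \<Rightarrow> 'a :: complex_vector"
  defines cspan_raw_def: cspan = complex_vector.span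
  by unfold_locales (rule scaleC_add_right scaleC_add_left scaleC_scaleC scaleC_one)+

text \<open>
  The Hermitian form is antilinear in its first and linear in its second argument.  The underlying
  real inner product is its real part, so the norm and the topology are those of the
  Hermitian form.
\<close>

class complex_inner = complex_vector + real_inner +
  fixes cinner :: "'a \<Rightarrow> 'a \<Rightarrow> complex"
  assumes cinner_commute: "cinner x y = cnj (cinner y x)"
    and cinner_add_right: "cinner x (y + z) = cinner x y + cinner x z"
    and cinner_scaleC_right: "cinner x (c *\<^sub>C y) = c * cinner x y"
    and inner_eq_Re_cinner: "inner x y = Re (cinner x y)"

text \<open>
  The assumption says that some finite set is contained in no proper complex subspace; it is spelled
  out because \<open>cspan\<close> is not available inside a class specification, and restated
  as \<open>finite_cspan\<close> below.  Completeness is automatic, and the zero space is not excluded.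
\<close>

class fin_dim_complex_hilbert = complex_inner +
  assumes finite_generating_set:
    "\<exists>B. finite B \<and> (\<forall>S. B \<subseteq> S \<and> 0 \<in> S \<and> (\<forall>x\<in>S. \<forall>y\<in>S. x + y \<in> S) \<and>
       (\<forall>c. \<forall>x\<in>S. c *\<^sub>C x \<in> S) \<longrightarrow> S = UNIV)"

lemma generating_set_iff_cspan:
  "(\<forall>S. B \<subseteq> S \<and> 0 \<in> S \<and> (\<forall>x\<in>S. \<forall>y\<in>S. x + y \<in> S) \<and> (\<forall>c. \<forall>x\<in>S. c *\<^sub>C x \<in> S) \<longrightarrow> S = UNIV)
     \<longleftrightarrow> cspan B = (UNIV :: 'a::complex_vector set)"
  (is "?L \<longleftrightarrow> ?R")
proof
  assume ?L
  then show ?R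
    by (elim allE[of _ "cspan B"])
      (auto intro: complex_vector.span_base complex_vector.span_zero complex_vector.span_add
        complex_vector.span_scale)
next
  assume R: ?R
  show ?L
  proof (intro allI impI)
    fix S assume S: "B \<subseteq> S \<and> 0 \<in> S \<and> (\<forall>x\<in>S. \<forall>y\<in>S. x + y \<in> S) \<and> (\<forall>c. \<forall>x\<in>S. c *\<^sub>C x \<in> S)"
    then have "cspan B \<subseteq> S"
      by (intro complex_vector.span_minimal) (auto simp: complex_vector.subspace_def)
    with R show "S = UNIV" by blast
  qed
qed

lemma finite_cspan: "\<exists>B :: 'a::fin_dim_complex_hilbert set. finite B \<and> cspan B = UNIV"
  using finite_generating_set unfolding generating_set_iff_cspan .

lemma cinner_add_left: "cinner (x + y) z = cinner x z + cinner y z"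
  by (metis cinner_commute cinner_add_right complex_cnj_add)

lemma cinner_scaleC_left: "cinner (c *\<^sub>C x) y = cnj c * cinner x y"
  by (metis cinner_commute cinner_scaleC_right complex_cnj_mult)

lemma cinner_self: "cinner x x = complex_of_real ((norm x)\<^sup>2)"
  using inner_eq_Re_cinner[of x x] cinner_commute[of x x]
  by (auto simp: complex_eq_iff power2_norm_eq_inner)

lemma norm_scaleC: "norm (c *\<^sub>C x) = cmod c * norm (x :: 'a :: complex_inner)"
proof -
  have "complex_of_real ((norm (c *\<^sub>C x))\<^sup>2) = (cnj c * c) * complex_of_real ((norm x)\<^sup>2)"
    by (simp only: cinner_self[symmetric] cinner_scaleC_left cinner_scaleC_right mult.assoc mult.left_commute)
  also have "\<dots> = complex_of_real ((cmod c * norm x)\<^sup>2)"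
    by (metis complex_norm_square mult.commute of_real_mult power_mult_distrib of_real_power)
  finally have "(norm (c *\<^sub>C x))\<^sup>2 = (cmod c * norm x)\<^sup>2"
    using of_real_eq_iff by blast
  thus ?thesis by (simp add: power2_eq_iff_nonneg)
qed


instantiation complex :: complex_vector
begin
definition scaleC_complex :: "complex \<Rightarrow> complex \<Rightarrow> complex" where "scaleC_complex c x = c * x"
instance
  by standard (auto simp: scaleC_complex_def algebra_simps scaleR_conv_of_real)
end

instantiation complex :: fin_dim_complex_hilbert
begin
definition cinner_complex :: "complex \<Rightarrow> complex \<Rightarrow> complex" where "cinner_complex x y = cnj x * y"
instance
proof
  have "\<exists>B::complex set. finite B \<and> cspan B = UNIV"
    by (rule exI[of _ "{1}"]) (auto simp: complex_vector.span_singleton scaleC_complex_def)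
  then show "\<exists>B::complex set. finite B \<and> (\<forall>S. B \<subseteq> S \<and> 0 \<in> S \<and> (\<forall>x\<in>S. \<forall>y\<in>S. x + y \<in> S) \<and>
       (\<forall>c. \<forall>x\<in>S. c *\<^sub>C x \<in> S) \<longrightarrow> S = UNIV)"
    unfolding generating_set_iff_cspan .
qed (auto simp: scaleC_complex_def cinner_complex_def algebra_simps inner_complex_def)
end

text \<open>The type \<open>'a \<times> 'b\<close> is the orthogonal direct sum.\<close>

instantiation prod :: (complex_vector, complex_vector) complex_vector
begin
definition scaleC_prod :: "complex \<Rightarrow> 'a \<times> 'b \<Rightarrow> 'a \<times> 'b" where
  "scaleC_prod c p = (c *\<^sub>C fst p, c *\<^sub>C snd p)"
instance
  by standard (auto simp: scaleC_prod_def scaleC_add_right scaleC_add_left scaleC_scaleC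
      scaleC_one scaleR_eq_scaleC scaleR_prod_def)
end

instantiation prod :: (complex_inner, complex_inner) complex_inner
begin
definition cinner_prod :: "'a \<times> 'b \<Rightarrow> 'a \<times> 'b \<Rightarrow> complex" where
  "cinner_prod p q = cinner (fst p) (fst q) + cinner (snd p) (snd q)"
instance
proof
  fix x y z :: "'a \<times> 'b" and c
  show "cinner x y = cnj (cinner y x)"
    unfolding cinner_prod_def complex_cnj_add by (metis cinner_commute)
qed (simp_all add: cinner_prod_def scaleC_prod_def cinner_add_right cinner_scaleC_right
      inner_eq_Re_cinner inner_prod_def algebra_simps)
end

instance prod :: (fin_dim_complex_hilbert, fin_dim_complex_hilbert) fin_dim_complex_hilbert
proof
  obtain A :: "'a set" where A: "finite A" "cspan A = UNIV" using finite_cspan by blast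
  obtain B :: "'b set" where B: "finite B" "cspan B = UNIV" using finite_cspan by blast
  let ?C = "(\<lambda>a. (a, 0 :: 'b)) ` A \<union> (\<lambda>b. (0 :: 'a, b)) ` B"
  have a: "(x, 0) \<in> cspan ?C" for x
  proof -
    have "x \<in> cspan A" using A by auto
    thus ?thesis
    proof (induction rule: complex_vector.span_induct_alt)
      case base
      show ?case using complex_vector.span_zero[of ?C] by (simp add: zero_prod_def)
    next
      case (step c x y)
      have "c *\<^sub>C (x, 0 :: 'b) + (y, 0) \<in> cspan ?C"
        using step by (intro complex_vector.span_add complex_vector.span_scale)
          (auto intro: complex_vector.span_base)
      thus ?case by (simp add: scaleC_prod_def)
    qed
  qed
  have b: "(0, x) \<in> cspan ?C" for x
  proof -
    have "x \<in> cspan B" using B by auto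
    thus ?thesis
    proof (induction rule: complex_vector.span_induct_alt)
      case base
      show ?case using complex_vector.span_zero[of ?C] by (simp add: zero_prod_def)
    next
      case (step c x y)
      have "c *\<^sub>C (0 :: 'a, x) + (0, y) \<in> cspan ?C"
        using step by (intro complex_vector.span_add complex_vector.span_scale)
          (auto intro: complex_vector.span_base)
      thus ?case by (simp add: scaleC_prod_def)
    qed
  qed
  have "p \<in> cspan ?C" for p
    using complex_vector.span_add[OF a[of "fst p"] b[of "snd p"]] by simp
  hence "\<exists>C::('a \<times> 'b) set. finite C \<and> cspan C = UNIV"
    using A(1) B(1) by (intro exI[of _ ?C]) auto
  then show "\<exists>C::('a \<times> 'b) set. finite C \<and> (\<forall>S. C \<subseteq> S \<and> 0 \<in> S \<and> (\<forall>x\<in>S. \<forall>y\<in>S. x + y \<in> S) \<and>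
       (\<forall>c. \<forall>x\<in>S. c *\<^sub>C x \<in> S) \<longrightarrow> S = UNIV)"
    unfolding generating_set_iff_cspan .
qed

section \<open>Operators\<close>

text \<open>
  \<open>\<L>(E, F)\<close> is the set of those \<open>A :: 'a \<Rightarrow>\<^sub>L 'b\<close> which satisfy \<open>clinear_op\<close>: the library type
  \<open>\<Rightarrow>\<^sub>L\<close> only provides real-linearity, boundedness and the operator norm.
\<close>

definition clinear_op :: "('a::complex_inner \<Rightarrow>\<^sub>L 'b::complex_inner) \<Rightarrow> bool" where
  "clinear_op A \<longleftrightarrow> Vector_Spaces.linear scaleC scaleC (blinfun_apply A)"

definition scalar_op :: "complex \<Rightarrow> 'a::complex_inner \<Rightarrow>\<^sub>L 'a" where
  "scalar_op z = Blinfun (\<lambda>x. z *\<^sub>C x)"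

lemma bounded_linear_scaleC: "bounded_linear (\<lambda>x :: 'a::complex_inner. z *\<^sub>C x)"
  by (rule bounded_linear_intro[where K = "cmod z"])
    (auto simp: scaleC_add_right scaleR_eq_scaleC scaleC_scaleC norm_scaleC mult.commute)

lemma scalar_op_apply [simp]: "scalar_op z x = z *\<^sub>C x"
  by (simp add: scalar_op_def bounded_linear_Blinfun_apply bounded_linear_scaleC)

definition invertible_op :: "('a::complex_inner \<Rightarrow>\<^sub>L 'a) \<Rightarrow> bool" where
  "invertible_op A \<longleftrightarrow> (\<exists>B. A o\<^sub>L B = id_blinfun \<and> B o\<^sub>L A = id_blinfun)"

definition inverse_op :: "('a::complex_inner \<Rightarrow>\<^sub>L 'a) \<Rightarrow> 'a \<Rightarrow>\<^sub>L 'a" where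
  "inverse_op A = (THE B. A o\<^sub>L B = id_blinfun \<and> B o\<^sub>L A = id_blinfun)"

definition hadjoint :: "('a::complex_inner \<Rightarrow>\<^sub>L 'b::complex_inner) \<Rightarrow> 'b \<Rightarrow>\<^sub>L 'a"
  (\<open>_\<^sup>\<dagger>\<close> [1000] 1000) where
  "A\<^sup>\<dagger> = (THE B :: 'b \<Rightarrow>\<^sub>L 'a. \<forall>x y. cinner (A x) y = cinner x (B y))"

definition cspectrum :: "('a::complex_inner \<Rightarrow>\<^sub>L 'a) \<Rightarrow> complex set" where
  "cspectrum A = {z. \<not> invertible_op (A - scalar_op z)}"

definition unitary_op :: "('a::complex_inner \<Rightarrow>\<^sub>L 'a) \<Rightarrow> bool" where
  "unitary_op U \<longleftrightarrow> clinear_op U \<and> U\<^sup>\<dagger> o\<^sub>L U = id_blinfun \<and> U o\<^sub>L U\<^sup>\<dagger> = id_blinfun"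

definition positive_op :: "('a::complex_inner \<Rightarrow>\<^sub>L 'a) \<Rightarrow> bool" where
  "positive_op P \<longleftrightarrow> clinear_op P \<and> P\<^sup>\<dagger> = P \<and> (\<forall>x. 0 \<le> Re (cinner x (P x)))"

definition sqrt_op :: "('a::complex_inner \<Rightarrow>\<^sub>L 'a) \<Rightarrow> 'a \<Rightarrow>\<^sub>L 'a" where
  "sqrt_op P = (THE S. positive_op S \<and> S o\<^sub>L S = P)"

definition unitary_polar_factor :: "('a::complex_inner \<Rightarrow>\<^sub>L 'a) \<Rightarrow> ('a \<Rightarrow>\<^sub>L 'a) \<Rightarrow> bool" where
  "unitary_polar_factor U A \<longleftrightarrow> unitary_op U \<and> (\<exists>P. positive_op P \<and> A = U o\<^sub>L P)"

text \<open>
  For self-adjoint \<open>H\<close> in finite dimension the negative spectral subspace, i.e. the range of the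
  spectral projection of the negative half-line, is spanned by the eigenvectors
  with negative eigenvalue.
\<close>

definition negative_spectral_subspace :: "('a::complex_inner \<Rightarrow>\<^sub>L 'a) \<Rightarrow> 'a set" where
  "negative_spectral_subspace H = cspan {v. \<exists>r<0. H v = r *\<^sub>R v}"

section \<open>Trace and determinant\<close>

definition orthonormal_basis :: "'a::complex_inner list \<Rightarrow> bool" where
  "orthonormal_basis bs \<longleftrightarrow>
     (\<forall>i<length bs. \<forall>j<length bs. cinner (bs ! i) (bs ! j) = (if i = j then 1 else 0)) \<and>
     cspan (set bs) = UNIV"

lemma cinner_sum_right: "cinner x (\<Sum>i\<in>I. f i) = (\<Sum>i\<in>I. cinner x (f i))"
proof -
  have "cinner x 0 = 0" using cinner_scaleC_right[of x 0 0] by simp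
  then show ?thesis by (induction I rule: infinite_finite_induct) (auto simp: cinner_add_right)
qed

lemma orthonormal_expansion:
  assumes "\<forall>i<length bs. \<forall>j<length bs. cinner (bs ! i) (bs ! j) = (if i = j then 1 else 0)"
    and "x \<in> cspan (set bs)"
  shows "x = (\<Sum>i<length bs. cinner (bs ! i) x *\<^sub>C bs ! i)"
  using assms(2)
proof (induction rule: complex_vector.span_induct_alt)
  case base
  have "cinner y 0 = 0" for y :: 'a using cinner_scaleC_right[of y 0 0] by simp
  then show ?case by simp
next
  case (step c b y)
  obtain k where k: "k < length bs" "b = bs ! k" using step(1) by (metis in_set_conv_nth)
  have "(\<Sum>i<length bs. cinner (bs ! i) (c *\<^sub>C b + y) *\<^sub>C bs ! i)
      = (\<Sum>i<length bs. (c * cinner (bs ! i) (bs ! k)) *\<^sub>C bs ! i) + y"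
    using arg_cong[OF step(2), of "\<lambda>u. (\<Sum>i<length bs. (c * cinner (bs ! i) (bs ! k)) *\<^sub>C bs ! i) + u"]
    by (simp add: cinner_add_right cinner_scaleC_right scaleC_add_left sum.distrib k)
  also have "(\<Sum>i<length bs. (c * cinner (bs ! i) (bs ! k)) *\<^sub>C bs ! i)
      = (\<Sum>i<length bs. if i = k then c *\<^sub>C bs ! k else 0)"
    using assms(1) k by (intro sum.cong) auto
  also have "\<dots> = c *\<^sub>C b" using k by simp
  finally show ?case by simp
qed

lemma orthonormal_basis_exists: "\<exists>bs :: 'a::fin_dim_complex_hilbert list. orthonormal_basis bs"
proof -
  have "\<exists>bs. (\<forall>i<length bs. \<forall>j<length bs. cinner (bs ! i) (bs ! j) = (if i = j then 1 else 0)) \<and>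
      B \<subseteq> cspan (set bs)" if "finite B" for B :: "'a set"
    using that
  proof (induction B)
    case empty
    show ?case by (rule exI[of _ "[]"]) auto
  next
    case (insert b B)
    then obtain bs where on: "\<And>i j. i < length bs \<Longrightarrow> j < length bs \<Longrightarrow>
          cinner (bs ! i) (bs ! j) = (if i = j then 1 else 0)"
      and sp: "B \<subseteq> cspan (set bs)" by blast
    define p where "p = (\<Sum>i<length bs. cinner (bs ! i) b *\<^sub>C bs ! i)"
    define r where "r = b - p"
    have p_in: "p \<in> cspan (set bs)"
      unfolding p_def
      by (intro complex_vector.span_sum complex_vector.span_scale complex_vector.span_base) auto
    have orth: "cinner (bs ! j) r = 0" if "j < length bs" for j
    proof -
      have "cinner (bs ! j) p = (\<Sum>i<length bs. if i = j then cinner (bs ! j) b else 0)"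
        unfolding p_def cinner_sum_right cinner_scaleC_right using on that
        by (intro sum.cong) auto
      also have "\<dots> = cinner (bs ! j) b" using that by simp
      finally have "cinner (bs ! j) (r + p) = cinner (bs ! j) r + cinner (bs ! j) b"
        by (simp add: cinner_add_right)
      then show ?thesis by (simp add: r_def)
    qed
    show ?case
    proof (cases "r = 0")
      case True
      then have "insert b B \<subseteq> cspan (set bs)" using p_in sp by (simp add: r_def)
      with on show ?thesis by blast
    next
      case False
      define e where "e = complex_of_real (1 / norm r) *\<^sub>C r"
      have ee: "cinner e e = 1"
        using False by (simp add: cinner_self, simp add: e_def norm_scaleC norm_divide)
      have eb: "cinner (bs ! j) e = 0" "cinner e (bs ! j) = 0" if "j < length bs" for j
        using orth[OF that] cinner_commute[of r "bs ! j"]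
        by (simp_all add: e_def cinner_scaleC_left cinner_scaleC_right)
      have 1: "cinner ((bs @ [e]) ! i) ((bs @ [e]) ! j) = (if i = j then 1 else 0)"
        if "i < length (bs @ [e])" "j < length (bs @ [e])" for i j
        using that on ee eb by (auto simp: nth_append less_Suc_eq)
      have mono: "cspan (set bs) \<subseteq> cspan (set (bs @ [e]))"
        by (intro complex_vector.span_mono) auto
      have "complex_of_real (norm r) *\<^sub>C e \<in> cspan (set (bs @ [e]))"
        by (intro complex_vector.span_scale complex_vector.span_base) auto
      then have "r \<in> cspan (set (bs @ [e]))"
        using False by (simp add: e_def scaleC_scaleC scaleC_one)
      then have "r + p \<in> cspan (set (bs @ [e]))"
        using p_in mono by (intro complex_vector.span_add) auto
      then have "insert b B \<subseteq> cspan (set (bs @ [e]))" using sp mono by (auto simp: r_def)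
      with 1 show ?thesis by blast
    qed
  qed
  moreover obtain B :: "'a set" where B: "finite B" "cspan B = UNIV" using finite_cspan by blast
  ultimately obtain bs :: "'a list" where
    on: "\<forall>i<length bs. \<forall>j<length bs. cinner (bs ! i) (bs ! j) = (if i = j then 1 else 0)"
    and sp: "B \<subseteq> cspan (set bs)" by blast
  have "cspan B \<subseteq> cspan (set bs)"
    using sp by (intro complex_vector.span_minimal) auto
  with on B show ?thesis unfolding orthonormal_basis_def by blast
qed

definition onb :: "'a::fin_dim_complex_hilbert list" where
  "onb = (SOME bs. orthonormal_basis bs)"

definition matrix_op :: "'a::complex_inner list \<Rightarrow> ('a \<Rightarrow>\<^sub>L 'a) \<Rightarrow> complex Matrix.mat" where
  "matrix_op bs A =
     Matrix.mat (length bs) (length bs) (\<lambda>(i, j). cinner (bs ! i) (A (bs ! j)))"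

text \<open>
  For complex-linear operators neither value depends on the choice of the orthonormal
  basis, see \<open>trace_op_eq\<close> and \<open>det_op_eq\<close> below.
\<close>

definition trace_op :: "('a::fin_dim_complex_hilbert \<Rightarrow>\<^sub>L 'a) \<Rightarrow> complex" where
  "trace_op A = (\<Sum>i<dim_row (matrix_op onb A). matrix_op onb A $$ (i, i))"

definition det_op :: "('a::fin_dim_complex_hilbert \<Rightarrow>\<^sub>L 'a) \<Rightarrow> complex" where
  "det_op A = Determinant.det (matrix_op onb A)"

lemma orthonormal_basis_onb: "orthonormal_basis onb"
  unfolding onb_def using orthonormal_basis_exists by (rule someI_ex)

lemma parseval:
  assumes "orthonormal_basis bs"
  shows "cinner x y = (\<Sum>i<length bs. cinner x (bs ! i) * cinner (bs ! i) y)"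
proof -
  have "y = (\<Sum>i<length bs. cinner (bs ! i) y *\<^sub>C bs ! i)"
    using assms by (intro orthonormal_expansion) (auto simp: orthonormal_basis_def)
  then have "cinner x y = cinner x (\<Sum>i<length bs. cinner (bs ! i) y *\<^sub>C bs ! i)" by simp
  then show ?thesis by (simp add: cinner_sum_right cinner_scaleC_right mult.commute)
qed

lemma cinner_apply_expansion:
  assumes "orthonormal_basis bs" and "clinear_op A"
  shows "cinner x (A y) = (\<Sum>i<length bs. cinner x (A (bs ! i)) * cinner (bs ! i) y)"
proof -
  interpret Vector_Spaces.linear scaleC scaleC "blinfun_apply A"
    using assms(2) by (simp add: clinear_op_def)
  have "y = (\<Sum>i<length bs. cinner (bs ! i) y *\<^sub>C bs ! i)"
    using assms by (intro orthonormal_expansion) (auto simp: orthonormal_basis_def)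
  then have "cinner x (A y) = cinner x (A (\<Sum>i<length bs. cinner (bs ! i) y *\<^sub>C bs ! i))" by simp
  then show ?thesis by (simp add: sum scale cinner_sum_right cinner_scaleC_right mult.commute)
qed

lemma orthonormal_basis_length:
  fixes bs cs :: "'a::complex_inner list"
  assumes "orthonormal_basis bs" and "orthonormal_basis cs"
  shows "length bs = length cs"
proof -
  have "complex_of_nat (length bs) = (\<Sum>i<length bs. cinner (bs ! i) (bs ! i))"
    using assms(1) by (simp add: orthonormal_basis_def)
  also have "\<dots> = (\<Sum>i<length bs. \<Sum>j<length cs. cinner (bs ! i) (cs ! j) * cinner (cs ! j) (bs ! i))"
    by (simp add: parseval[OF assms(2), symmetric])
  also have "\<dots> = (\<Sum>j<length cs. \<Sum>i<length bs. cinner (cs ! j) (bs ! i) * cinner (bs ! i) (cs ! j))"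
    by (subst sum.swap) (simp add: mult.commute)
  also have "\<dots> = (\<Sum>j<length cs. cinner (cs ! j) (cs ! j))"
    by (simp add: parseval[OF assms(1), symmetric])
  also have "\<dots> = complex_of_nat (length cs)"
    using assms(2) by (simp add: orthonormal_basis_def)
  finally show ?thesis by simp
qed

lemma trace_op_eq:
  fixes A :: "'a::fin_dim_complex_hilbert \<Rightarrow>\<^sub>L 'a"
  assumes "orthonormal_basis bs" and "clinear_op A"
  shows "trace_op A = (\<Sum>i<length bs. cinner (bs ! i) (A (bs ! i)))"
proof -
  let ?cs = "onb :: 'a list"
  have "trace_op A = (\<Sum>i<length ?cs. \<Sum>j<length bs.
      cinner (?cs ! i) (A (bs ! j)) * cinner (bs ! j) (?cs ! i))"
    unfolding trace_op_def matrix_op_def by (simp add: cinner_apply_expansion[OF assms, symmetric])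
  also have "\<dots> = (\<Sum>j<length bs. \<Sum>i<length ?cs.
      cinner (bs ! j) (?cs ! i) * cinner (?cs ! i) (A (bs ! j)))"
    by (subst sum.swap) (simp add: mult.commute)
  finally show ?thesis by (simp add: parseval[OF orthonormal_basis_onb, symmetric])
qed

lemma det_op_eq:
  fixes A :: "'a::fin_dim_complex_hilbert \<Rightarrow>\<^sub>L 'a"
  assumes "orthonormal_basis bs" and "clinear_op A"
  shows "det_op A = Determinant.det (matrix_op bs A)"
proof -
  let ?cs = "onb :: 'a list"
  define n where "n = length bs"
  have n: "length ?cs = n" "length bs = n"
    using orthonormal_basis_length[OF orthonormal_basis_onb assms(1)] by (simp_all add: n_def)
  define U where "U = Matrix.mat n n (\<lambda>(i, j). cinner (?cs ! i) (bs ! j))"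
  define V where "V = Matrix.mat n n (\<lambda>(i, j). cinner (bs ! i) (?cs ! j))"
  define B where "B = matrix_op bs A"
  have car: "U \<in> carrier_mat n n" "V \<in> carrier_mat n n" "B \<in> carrier_mat n n"
    by (simp_all add: U_def V_def B_def matrix_op_def n)
  have UV: "U * V = 1\<^sub>m n"
  proof (rule eq_matI)
    fix i j assume ij: "i < dim_row (1\<^sub>m n :: complex Matrix.mat)" "j < dim_col (1\<^sub>m n :: complex Matrix.mat)"
    have "(U * V) $$ (i, j) = (\<Sum>k<n. cinner (?cs ! i) (bs ! k) * cinner (bs ! k) (?cs ! j))"
      using ij by (simp add: U_def V_def scalar_prod_def lessThan_atLeast0)
    also have "\<dots> = cinner (?cs ! i) (?cs ! j)"
      using parseval[OF assms(1), of "?cs ! i" "?cs ! j"] by (simp add: n)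
    finally show "(U * V) $$ (i, j) = 1\<^sub>m n $$ (i, j)"
      using ij orthonormal_basis_onb n by (auto simp: orthonormal_basis_def)
  qed (use car in auto)
  have "matrix_op ?cs A = U * (B * V)"
  proof (rule eq_matI)
    fix i l assume "i < dim_row (U * (B * V))" "l < dim_col (U * (B * V))"
    then have il: "i < n" "l < n" using car by auto
    have *: "(B * V) $$ (k, l) = cinner (bs ! k) (A (?cs ! l))" if "k < n" for k
      using that il cinner_apply_expansion[OF assms, of "bs ! k" "?cs ! l"]
      by (simp add: B_def matrix_op_def V_def scalar_prod_def lessThan_atLeast0 n)
    have "(U * (B * V)) $$ (i, l) = (\<Sum>k<n. U $$ (i, k) * (B * V) $$ (k, l))"
      using car il by (simp add: scalar_prod_def lessThan_atLeast0)
    also have "\<dots> = (\<Sum>k<n. cinner (?cs ! i) (bs ! k) * cinner (bs ! k) (A (?cs ! l)))"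
      using il by (intro sum.cong) (auto simp: * U_def)
    also have "\<dots> = cinner (?cs ! i) (A (?cs ! l))"
      using parseval[OF assms(1), of "?cs ! i" "A (?cs ! l)"] by (simp add: n)
    finally show "matrix_op ?cs A $$ (i, l) = (U * (B * V)) $$ (i, l)"
      using il by (simp add: matrix_op_def n)
  qed (use car in \<open>auto simp: matrix_op_def n\<close>)
  then have "det_op A = Determinant.det U * (Determinant.det B * Determinant.det V)"
    using car by (simp add: det_op_def Determinant.det_mult[of _ n])
  also have "\<dots> = Determinant.det (U * V) * Determinant.det B"
    using car by (simp add: Determinant.det_mult[of _ n])
  finally show ?thesis by (simp add: UV B_def)
qed

lemma hadjoint_unique:
  fixes A :: "'a::complex_inner \<Rightarrow>\<^sub>L 'b::complex_inner" and B :: "'b \<Rightarrow>\<^sub>L 'a"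
  assumes "\<And>x y. cinner (A x) y = cinner x (B y)"
  shows "A\<^sup>\<dagger> = B"
  unfolding hadjoint_def
proof (rule the_equality)
  fix C :: "'b \<Rightarrow>\<^sub>L 'a" assume C: "\<forall>x y. cinner (A x) y = cinner x (C y)"
  show "C = B"
  proof (rule blinfun_eqI)
    fix y
    have "inner (C y - B y) (C y) = inner (C y - B y) (B y)"
      using C assms by (metis inner_eq_Re_cinner)
    then have "inner (C y - B y) (C y - B y) = 0" by (simp add: inner_diff_right)
    then show "C y = B y" by simp
  qed
qed (use assms in blast)

lemma hadjoint:
  fixes A :: "'a::fin_dim_complex_hilbert \<Rightarrow>\<^sub>L 'b::complex_inner"
  assumes "clinear_op A"
  shows "cinner (A x) y = cinner x ((A\<^sup>\<dagger>) y)"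
proof -
  interpret Vector_Spaces.linear scaleC scaleC "blinfun_apply A"
    using assms by (simp add: clinear_op_def)
  let ?e = "onb :: 'a list"
  define B where "B = Blinfun (\<lambda>y. \<Sum>i<length ?e. cinner (A (?e ! i)) y *\<^sub>C ?e ! i)"
  have re: "cinner u (r *\<^sub>R v) = complex_of_real r * cinner u v" for u v :: 'b and r
    by (simp add: scaleR_eq_scaleC cinner_scaleC_right)
  have cs: "cmod (cinner u v) \<le> norm u * norm v" for u v :: 'b
  proof -
    define w where "w = (if cinner u v = 0 then 0 else cnj (cinner u v) / cmod (cinner u v))"
    have w: "cmod w \<le> 1" "w * cinner u v = complex_of_real (cmod (cinner u v))"
      by (auto simp: w_def norm_divide complex_norm_square[symmetric] power2_eq_square field_simps)
    have "cmod (cinner u v) = inner u (w *\<^sub>C v)"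
      by (simp add: inner_eq_Re_cinner cinner_scaleC_right w)
    also have "\<dots> \<le> norm u * norm (w *\<^sub>C v)" by (rule norm_cauchy_schwarz)
    also have "\<dots> \<le> norm u * norm v"
      using w by (intro mult_left_mono) (auto simp: norm_scaleC mult_left_le_one_le)
    finally show ?thesis .
  qed
  have "bounded_linear (\<lambda>y. cinner (A (?e ! i)) y *\<^sub>C ?e ! i)" for i
  proof (rule bounded_linear_intro)
    fix y
    have "norm (cinner (A (?e ! i)) y *\<^sub>C ?e ! i) \<le> (norm (A (?e ! i)) * norm y) * norm (?e ! i)"
      unfolding norm_scaleC by (intro mult_right_mono cs) auto
    then show "norm (cinner (A (?e ! i)) y *\<^sub>C ?e ! i) \<le> norm y * (norm (A (?e ! i)) * norm (?e ! i))"
      by (simp add: algebra_simps)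
  qed (auto simp: cinner_add_right scaleC_add_left re scaleC_scaleC scaleR_eq_scaleC cinner_scaleC_right)
  then have "bounded_linear (\<lambda>y. \<Sum>i<length ?e. cinner (A (?e ! i)) y *\<^sub>C ?e ! i)"
    by (intro bounded_linear_sum) auto
  then have B: "B y = (\<Sum>i<length ?e. cinner (A (?e ! i)) y *\<^sub>C ?e ! i)" for y
    by (simp add: B_def bounded_linear_Blinfun_apply)
  have "cinner (A x) y = cinner x (B y)" for x y
  proof -
    have "cinner x (B y) = (\<Sum>i<length ?e. cinner (A (?e ! i)) y * cinner x (?e ! i))"
      by (simp add: B cinner_sum_right cinner_scaleC_right)
    also have "\<dots> = cnj (\<Sum>i<length ?e. cinner y (A (?e ! i)) * cinner (?e ! i) x)"
      by (simp add: cinner_commute[of y] cinner_commute[of _ x])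
    also have "\<dots> = cnj (cinner y (A x))"
      using cinner_apply_expansion[OF orthonormal_basis_onb assms, of y x] by simp
    finally show ?thesis by (simp add: cinner_commute[of "A x"])
  qed
  then show ?thesis using hadjoint_unique by metis
qed

section \<open>Periodic loops, point gaps and winding\<close>

text \<open>Loops are functions on the reals of which only the values on \<open>{0..2 * pi}\<close> matter.\<close>

definition C1_periodic_loop ::
  "(real \<Rightarrow> 'a::complex_inner \<Rightarrow>\<^sub>L 'b::complex_inner) \<Rightarrow> bool" where
  "C1_periodic_loop M \<longleftrightarrow>
     (\<forall>t\<in>{0..2*pi}. clinear_op (M t)) \<and>
     (\<exists>N. N C1_differentiable_on UNIV \<and> (\<forall>t. N (t + 2*pi) = N t) \<and> (\<forall>t\<in>{0..2*pi}. N t = M t))"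

text \<open>The derivative \<open>\<partial>\<^sub>t\<close> on the parameter interval, one-sided at its end points.\<close>

definition loop_deriv :: "(real \<Rightarrow> 'a::real_normed_vector) \<Rightarrow> real \<Rightarrow> 'a" where
  "loop_deriv F t = vector_derivative F (at t within {0..2*pi})"

definition shifted :: "(real \<Rightarrow> 'a::complex_inner \<Rightarrow>\<^sub>L 'a) \<Rightarrow> complex \<Rightarrow> real \<Rightarrow> 'a \<Rightarrow>\<^sub>L 'a" where
  "shifted M z t = M t - scalar_op z"

definition point_gap :: "(real \<Rightarrow> 'a::complex_inner \<Rightarrow>\<^sub>L 'a) \<Rightarrow> complex \<Rightarrow> bool" where
  "point_gap M z \<longleftrightarrow> (\<forall>t\<in>{0..2*pi}. invertible_op (shifted M z t))"

text \<open>
  The library's winding number takes paths on \<open>{0..1}\<close>, and is complex-valued; it is an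
  integer for closed paths.
\<close>

definition det_winding ::
  "(real \<Rightarrow> 'a::fin_dim_complex_hilbert \<Rightarrow>\<^sub>L 'a) \<Rightarrow> complex \<Rightarrow> complex" where
  "det_winding M z = winding_number (\<lambda>s. det_op (shifted M z (2*pi * s))) 0"

section \<open>The polar unitary and the Hermitized family\<close>

definition polar_unitary ::
  "(real \<Rightarrow> 'a::complex_inner \<Rightarrow>\<^sub>L 'a) \<Rightarrow> complex \<Rightarrow> real \<Rightarrow> 'a \<Rightarrow>\<^sub>L 'a" where
  "polar_unitary M z t =
     shifted M z t o\<^sub>L inverse_op (sqrt_op ((shifted M z t)\<^sup>\<dagger> o\<^sub>L shifted M z t))"

definition hermitization ::
  "(real \<Rightarrow> 'a::complex_inner \<Rightarrow>\<^sub>L 'a) \<Rightarrow> complex \<Rightarrow> real \<Rightarrow> ('a \<times> 'a) \<Rightarrow>\<^sub>L ('a \<times> 'a)" where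
  "hermitization M z t = Blinfun (\<lambda>(x, y). (shifted M z t y, (shifted M z t)\<^sup>\<dagger> x))"

definition negative_frame ::
  "(real \<Rightarrow> 'a::complex_inner \<Rightarrow>\<^sub>L 'a) \<Rightarrow> complex \<Rightarrow> real \<Rightarrow> 'a \<Rightarrow>\<^sub>L ('a \<times> 'a)" where
  "negative_frame M z t = Blinfun (\<lambda>x. (1 / sqrt 2) *\<^sub>R (- polar_unitary M z t x, x))"

lemma hermitization_apply [simp]:
  "hermitization M z t (x, y) = (shifted M z t y, (shifted M z t)\<^sup>\<dagger> x)"
proof -
  have "bounded_linear (\<lambda>p. (shifted M z t (snd p), (shifted M z t)\<^sup>\<dagger> (fst p)))"
    by (intro bounded_linear_intros)
  then show ?thesis
    by (simp add: hermitization_def case_prod_unfold bounded_linear_Blinfun_apply)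
qed

lemma negative_frame_apply [simp]:
  "negative_frame M z t x = (1 / sqrt 2) *\<^sub>R (- polar_unitary M z t x, x)"
proof -
  have "bounded_linear (\<lambda>x. (1 / sqrt 2) *\<^sub>R (- polar_unitary M z t x, x))"
    by (intro bounded_linear_intros bounded_linear_minus)
  then show ?thesis by (simp add: negative_frame_def bounded_linear_Blinfun_apply)
qed

definition zak_phase ::
  "(real \<Rightarrow> 'a::fin_dim_complex_hilbert \<Rightarrow>\<^sub>L 'b::complex_inner) \<Rightarrow> complex" where
  "zak_phase \<Psi> = \<i> * integral {0..2*pi} (\<lambda>t. trace_op ((\<Psi> t)\<^sup>\<dagger> o\<^sub>L loop_deriv \<Psi> t))"

end

theory Submission
  imports Defs
begin

text \<open>
  Everything is read off the polar decomposition \<open>A = Q S\<close> of \<open>A = M - z\<close>, where \<open>S\<close> is the positive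
  square root of the Gram operator of \<open>A\<close> and \<open>Q\<close> is unitary (\<open>polar_decomposition\<close>).  The point gap
  makes every \<open>A t\<close> injective, and by compactness of the period and of the unit sphere there is one
  \<open>m > 0\<close> with \<open>m * norm x \<le> norm (A t x)\<close> for all \<open>t\<close> and \<open>x\<close> (\<open>uniformly_bounded_below\<close>).  The
  same \<open>m\<close> bounds \<open>S\<close> from below and is a spectral gap of the Hermitized operator.

  The algebraic claims need the spectral theorem for Hermitian operators: it yields square roots,
  inverses, and an eigenbasis of \<open>S\<close>.  The frame carries an eigenvector of \<open>S\<close> for \<open>r\<close> to an eigenvector
  of the Hermitized operator for \<open>- r\<close>, and these span the negative spectral subspace
  (\<open>range_negative_frame\<close>).

  The analytic point is that \<open>S\<close>, hence \<open>Q\<close>, depends on \<open>t\<close> in a continuously differentiable way.  Increments,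
  difference quotients and the derivative of \<open>S\<close> all solve equations of the form \<open>S Y + Y T = R\<close>,
  and if \<open>S\<close> and \<open>T\<close> are positive, one of them definite, and \<open>Y\<close> is Hermitian, then the norm of \<open>R\<close>
  controls that of \<open>Y\<close> (\<open>sylvester_estimate\<close>); the same estimate gives uniqueness of square roots and with it
  uniqueness of the polar factor.

  For the winding number, the determinant of \<open>A\<close> is that of \<open>Q\<close> times the positive number \<open>det S\<close>, so both
  determinants wind equally often around \<open>0\<close> (\<open>winding_number_positive_multiple\<close>).  By Jacobi's
  formula the logarithmic derivative of \<open>det Q\<close> is the trace of the adjoint of \<open>Q\<close> composed with the
  derivative of \<open>Q\<close> (\<open>det_op_unitary_derivative\<close>), and integrating it gives the winding number.  In
  the Zak phase the constant component of the frame does not contribute, and the factor \<open>1 / sqrt 2\<close>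
  enters twice, so its integrand is half of the integrand for \<open>Q\<close>; hence the phase \<open>- pi * W\<close>, which
  differs from \<open>pi * W\<close> by a multiple of \<open>2 * pi\<close> because \<open>W\<close> is an integer.
\<close>

section \<open>The Hermitian form\<close>

lemma cinner_zero_right [simp]: "cinner x 0 = 0"
  using cinner_scaleC_right[of x 0 0] by simp

lemma cinner_zero_left [simp]: "cinner 0 x = 0"
  using cinner_scaleC_left[of 0 0 x] by simp

lemma cinner_minus_right: "cinner x (- y) = - cinner x y"
proof (rule minus_unique[symmetric])
  show "cinner x y + cinner x (- y) = 0"
    unfolding cinner_add_right[symmetric] by simp
qed

lemma cinner_minus_left: "cinner (- x) y = - cinner x y"
proof (rule minus_unique[symmetric])
  show "cinner x y + cinner (- x) y = 0"
    unfolding cinner_add_left[symmetric] by simp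
qed

lemma cinner_diff_right: "cinner x (y - z) = cinner x y - cinner x z"
  using cinner_add_right[of x y "- z"] by (simp add: cinner_minus_right)

lemma cinner_diff_left: "cinner (x - y) z = cinner x z - cinner y z"
  using cinner_add_left[of x "- y" z] by (simp add: cinner_minus_left)

lemma cinner_scaleR_right: "cinner x (r *\<^sub>R y) = r *\<^sub>R cinner x y"
  by (simp add: scaleR_eq_scaleC[of r y] cinner_scaleC_right scaleR_conv_of_real)

lemma cinner_scaleR_left: "cinner (r *\<^sub>R x) y = r *\<^sub>R cinner x y"
  by (simp add: scaleR_eq_scaleC[of r x] cinner_scaleC_left scaleR_conv_of_real)

lemma cinner_sum_left: "cinner (\<Sum>i\<in>I. f i) x = (\<Sum>i\<in>I. cinner (f i) x)"
  by (induction I rule: infinite_finite_induct) (auto simp: cinner_add_left)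

lemma cinner_extensional: "(\<And>x. cinner x y = cinner x z) \<Longrightarrow> y = z"
  using cinner_self[of "y - z"] by (simp add: cinner_diff_right)

lemma norm_eq_1_cinner: "norm x = 1 \<longleftrightarrow> cinner x x = 1"
proof -
  have "cinner x x = 1 \<longleftrightarrow> (norm x)\<^sup>2 = 1"
    unfolding cinner_self by (rule of_real_eq_1_iff)
  then show ?thesis using power2_eq_iff_nonneg[of "norm x" 1] by simp
qed

lemma Re_cinner_self: "Re (cinner x x) = (norm x)\<^sup>2"
  by (simp add: cinner_self)

lemma Re_cinner_commute: "Re (cinner x y) = Re (cinner y x)"
  by (subst cinner_commute) simp

text \<open>Multiplying \<open>v\<close> by a phase makes \<open>cinner u v\<close> real, which reduces the inequality to the
  one for the underlying real inner product.\<close>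

lemma cmod_cinner_le: "cmod (cinner u v) \<le> norm u * norm v"
proof -
  define w where "w = cis (- Arg (cinner u v))"
  have "w * cinner u v = w * (complex_of_real (cmod (cinner u v)) * cis (Arg (cinner u v)))"
    using rcis_cmod_Arg[of "cinner u v"] by (simp add: rcis_def)
  also have "\<dots> = complex_of_real (cmod (cinner u v)) * (w * cis (Arg (cinner u v)))"
    by (simp only: mult_ac)
  also have "w * cis (Arg (cinner u v)) = 1" by (simp add: w_def cis_mult)
  finally have "w * cinner u v = complex_of_real (cmod (cinner u v))" by simp
  then have "cmod (cinner u v) = inner u (w *\<^sub>C v)"
    by (simp add: inner_eq_Re_cinner cinner_scaleC_right)
  also have "\<dots> \<le> norm u * norm (w *\<^sub>C v)" by (rule norm_cauchy_schwarz)
  finally show ?thesis by (simp add: norm_scaleC w_def)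
qed

lemma bounded_bilinear_cinner: "bounded_bilinear (cinner :: 'a::complex_inner \<Rightarrow> 'a \<Rightarrow> complex)"
  by standard
    (auto simp: cinner_add_left cinner_add_right cinner_scaleR_left cinner_scaleR_right
      intro!: exI[of _ 1] cmod_cinner_le)

lemma bounded_bilinear_scaleC: "bounded_bilinear (scaleC :: complex \<Rightarrow> 'a::complex_inner \<Rightarrow> 'a)"
proof standard
  fix a a' :: complex and b b' :: 'a and r :: real
  show "(a + a') *\<^sub>C b = a *\<^sub>C b + a' *\<^sub>C b" by (rule scaleC_add_left)
  show "a *\<^sub>C (b + b') = a *\<^sub>C b + a *\<^sub>C b'" by (rule scaleC_add_right)
  show "(r *\<^sub>R a) *\<^sub>C b = r *\<^sub>R (a *\<^sub>C b)"
    by (simp only: scaleR_eq_scaleC[of r "a *\<^sub>C b"] scaleC_scaleC scaleR_conv_of_real)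
  show "a *\<^sub>C (r *\<^sub>R b) = r *\<^sub>R (a *\<^sub>C b)"
    by (simp only: scaleR_eq_scaleC[of r "a *\<^sub>C b"] scaleR_eq_scaleC[of r b] scaleC_scaleC mult.commute)
  show "\<exists>K. \<forall>a b. norm (a *\<^sub>C (b :: 'a)) \<le> norm a * norm b * K"
    by (intro exI[of _ 1]) (simp add: norm_scaleC)
qed

lemmas continuous_on_cinner = bounded_bilinear.continuous_on[OF bounded_bilinear_cinner]
lemmas continuous_on_scaleC = bounded_bilinear.continuous_on[OF bounded_bilinear_scaleC]

section \<open>Compactness of the unit sphere\<close>

text \<open>The dimension is not encoded in the type, so the Heine--Borel theorem does not apply directly; instead
  the box spanned by finitely many vectors is built up one disc at a time.\<close>

lemma compact_box_combinations:
  fixes f :: "nat \<Rightarrow> 'a::complex_inner"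
  shows "compact {\<Sum>i<n. c i *\<^sub>C f i |c. \<forall>i<n. cmod (c i) \<le> 1}" (is "compact (?K n)")
proof (induction n)
  case 0
  show ?case by simp
next
  case (Suc n)
  have "compact ((\<lambda>c. c *\<^sub>C f n) ` cball 0 1)"
    by (intro compact_continuous_image continuous_on_scaleC continuous_intros compact_cball)
  from compact_sums[OF Suc this] show ?case
  proof (rule back_subst[where P = compact], intro equalityI subsetI)
    fix v assume "v \<in> {x + y |x y. x \<in> ?K n \<and> y \<in> (\<lambda>c. c *\<^sub>C f n) ` cball 0 1}"
    then obtain c d where cd: "\<forall>i<n. cmod (c i) \<le> 1" "cmod d \<le> 1"
      and v: "v = (\<Sum>i<n. c i *\<^sub>C f i) + d *\<^sub>C f n" by auto
    have "v = (\<Sum>i<Suc n. (c(n := d)) i *\<^sub>C f i)" unfolding v by simp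
    moreover have "\<forall>i<Suc n. cmod ((c(n := d)) i) \<le> 1" using cd by (simp add: less_Suc_eq)
    ultimately show "v \<in> ?K (Suc n)" by blast
  next
    fix v assume "v \<in> ?K (Suc n)"
    then obtain c where c: "\<forall>i<Suc n. cmod (c i) \<le> 1" and v: "v = (\<Sum>i<Suc n. c i *\<^sub>C f i)"
      by blast
    have "(\<Sum>i<n. c i *\<^sub>C f i) \<in> ?K n" using c by force
    moreover have "c n *\<^sub>C f n \<in> (\<lambda>c. c *\<^sub>C f n) ` cball 0 1" using c by auto
    ultimately show "v \<in> {x + y |x y. x \<in> ?K n \<and> y \<in> (\<lambda>c. c *\<^sub>C f n) ` cball 0 1}"
      unfolding v by auto
  qed
qed

lemma compact_unit_sphere: "compact (sphere (0 :: 'a::fin_dim_complex_hilbert) 1)"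
proof -
  let ?e = "onb :: 'a list"
  have on: "\<forall>i<length ?e. \<forall>j<length ?e. cinner (?e ! i) (?e ! j) = (if i = j then 1 else 0)"
    and sp: "cspan (set ?e) = UNIV"
    using orthonormal_basis_onb by (auto simp: orthonormal_basis_def)
  have ne: "norm (?e ! i) = 1" if "i < length ?e" for i
    using on that by (simp add: norm_eq_1_cinner)
  define K where "K = {\<Sum>i<length ?e. c i *\<^sub>C ?e ! i |c. \<forall>i<length ?e. cmod (c i) \<le> 1}"
  have "x \<in> K" if "norm x = 1" for x
  proof -
    have "x = (\<Sum>i<length ?e. cinner (?e ! i) x *\<^sub>C ?e ! i)"
      by (rule orthonormal_expansion[OF on]) (simp add: sp)
    moreover have "cmod (cinner (?e ! i) x) \<le> 1" if "i < length ?e" for i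
      using cmod_cinner_le[of "?e ! i" x] ne[OF that] \<open>norm x = 1\<close> by simp
    ultimately show "x \<in> K"
      unfolding K_def by (intro CollectI exI[of _ "\<lambda>i. cinner (?e ! i) x"] conjI allI impI)
  qed
  then have eq: "sphere 0 1 = K \<inter> sphere (0 :: 'a) 1" by auto
  have "closed (norm -` {1 :: real} :: 'a set)"
    by (intro closed_vimage closed_singleton continuous_intros)
  then have cl: "closed (sphere (0 :: 'a) 1)" by (simp add: vimage_def sphere_def)
  have "compact K" unfolding K_def by (rule compact_box_combinations)
  from compact_Int_closed[OF this cl] show ?thesis by (subst eq)
qed

section \<open>The spectral theorem\<close>

text \<open>Symmetry of the form forces complex-linearity and determines the adjoint, so it can be stated
  without mentioning either; it is also visibly a closed real-linear condition on \<open>A\<close>, which derivatives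
  inherit.\<close>

definition hermitian_op :: "('a::complex_inner \<Rightarrow>\<^sub>L 'a) \<Rightarrow> bool" where
  "hermitian_op A \<longleftrightarrow> (\<forall>x y. cinner (A x) y = cinner x (A y))"

lemma hermitian_opD: "hermitian_op A \<Longrightarrow> cinner (A x) y = cinner x (A y)"
  by (simp add: hermitian_op_def)

lemma clinear_opI:
  assumes "\<And>c x. blinfun_apply A (c *\<^sub>C x) = c *\<^sub>C A x"
  shows "clinear_op A"
  unfolding clinear_op_def
  by unfold_locales (simp_all add: assms blinfun.add_right)

lemma clinear_op_scaleC: "clinear_op A \<Longrightarrow> A (c *\<^sub>C x) = c *\<^sub>C A x"
  unfolding clinear_op_def by (simp add: Vector_Spaces.linear_iff)

lemma hermitian_imp_clinear: "hermitian_op A \<Longrightarrow> clinear_op A"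
proof (rule clinear_opI, rule cinner_extensional)
  fix c x y assume A: "hermitian_op A"
  have "cinner y (A (c *\<^sub>C x)) = c * cinner (A y) x"
    unfolding hermitian_opD[OF A, symmetric] by (rule cinner_scaleC_right)
  also have "\<dots> = cinner y (c *\<^sub>C A x)"
    unfolding hermitian_opD[OF A] by (rule cinner_scaleC_right[symmetric])
  finally show "cinner y (A (c *\<^sub>C x)) = cinner y (c *\<^sub>C A x)" .
qed

lemma hermitian_op_adjoint: "hermitian_op A \<Longrightarrow> A\<^sup>\<dagger> = A"
  by (intro hadjoint_unique) (simp add: hermitian_opD)

lemma hermitian_op_iff:
  fixes A :: "'a::fin_dim_complex_hilbert \<Rightarrow>\<^sub>L 'a"
  shows "hermitian_op A \<longleftrightarrow> clinear_op A \<and> A\<^sup>\<dagger> = A"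
  using hermitian_imp_clinear hermitian_op_adjoint hadjoint[of A]
  by (auto simp: hermitian_op_def)

definition orthonormal_list :: "'a::complex_inner list \<Rightarrow> bool" where
  "orthonormal_list bs \<longleftrightarrow>
     (\<forall>i<length bs. \<forall>j<length bs. cinner (bs ! i) (bs ! j) = (if i = j then 1 else 0))"

lemma orthonormal_list_snoc:
  assumes "orthonormal_list bs" and "norm e = 1" and "\<And>b. b \<in> set bs \<Longrightarrow> cinner b e = 0"
  shows "orthonormal_list (bs @ [e])"
proof -
  have "cinner e b = 0" if "b \<in> set bs" for b
    using assms(3)[OF that] cinner_commute[of e b] by simp
  then show ?thesis
    using assms by (auto simp: orthonormal_list_def nth_append less_Suc_eq cinner_self)
qed

lemma orthogonal_projection:
  assumes "orthonormal_list bs" and "b \<in> set bs"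
  shows "cinner b (x - (\<Sum>i<length bs. cinner (bs ! i) x *\<^sub>C bs ! i)) = 0"
proof -
  obtain j where j: "j < length bs" "b = bs ! j" using assms(2) by (metis in_set_conv_nth)
  have "cinner b (\<Sum>i<length bs. cinner (bs ! i) x *\<^sub>C bs ! i)
      = (\<Sum>i<length bs. cinner (bs ! i) x * cinner (bs ! j) (bs ! i))"
    by (simp add: j cinner_sum_right cinner_scaleC_right)
  also have "\<dots> = (\<Sum>i<length bs. if i = j then cinner (bs ! j) x else 0)"
    using assms(1) j by (intro sum.cong) (auto simp: orthonormal_list_def)
  also have "\<dots> = cinner b x" using j by simp
  finally show ?thesis by (simp add: cinner_diff_right)
qed

text \<open>Summing Bessel's inequality over an orthonormal basis bounds the number of vectors by the dimension.
  This makes an orthonormal list of maximal length available, whatever property its members have.\<close>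

lemma orthonormal_list_length_le:
  fixes bs :: "'a::fin_dim_complex_hilbert list"
  assumes "orthonormal_list bs"
  shows "length bs \<le> length (onb :: 'a list)"
proof -
  let ?e = "onb :: 'a list"
  have sq: "cinner x y * cinner y x = complex_of_real ((cmod (cinner x y))\<^sup>2)" for x y :: 'a
    unfolding cinner_commute[of y x] by (simp only: complex_norm_square)
  have bessel: "(\<Sum>i<length bs. (cmod (cinner (bs ! i) x))\<^sup>2) \<le> (norm x)\<^sup>2" for x
  proof -
    define p where "p = (\<Sum>i<length bs. cinner (bs ! i) x *\<^sub>C bs ! i)"
    have "cinner p (x - p) = (\<Sum>i<length bs. cnj (cinner (bs ! i) x) * cinner (bs ! i) (x - p))"
      unfolding p_def[of] by (simp only: cinner_sum_left cinner_scaleC_left)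
    also have "\<dots> = 0"
      using orthogonal_projection[OF assms] by (intro sum.neutral) (simp add: p_def)
    finally have px: "cinner p (x - p) = 0" .
    have "0 \<le> Re (cinner (x - p) (x - p))" by (simp add: Re_cinner_self)
    also have "\<dots> = Re (cinner x x) - Re (cinner p x)"
      using arg_cong[OF px, of Re] Re_cinner_commute[of x p]
      unfolding cinner_diff_left cinner_diff_right by simp
    also have "cinner p x = (\<Sum>i<length bs. complex_of_real ((cmod (cinner (bs ! i) x))\<^sup>2))"
      unfolding p_def cinner_sum_left cinner_scaleC_left
      by (intro sum.cong refl) (simp only: complex_norm_square mult.commute)
    finally show ?thesis by (simp add: Re_cinner_self)
  qed
  have one: "norm (?e ! j) = 1" if "j < length ?e" for j
    using orthonormal_basis_onb[where 'a = 'a] that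
    unfolding norm_eq_1_cinner orthonormal_basis_def by simp
  have "complex_of_real (length bs) = (\<Sum>i<length bs. cinner (bs ! i) (bs ! i))"
    using assms by (simp add: orthonormal_list_def)
  also have "\<dots> = complex_of_real (\<Sum>i<length bs. \<Sum>j<length ?e. (cmod (cinner (bs ! i) (?e ! j)))\<^sup>2)"
  proof -
    have "cinner b b = complex_of_real (\<Sum>j<length ?e. (cmod (cinner b (?e ! j)))\<^sup>2)" for b
      by (subst parseval[OF orthonormal_basis_onb]) (simp only: sq of_real_sum)
    then show ?thesis by (simp only: of_real_sum)
  qed
  finally have "real (length bs) = (\<Sum>i<length bs. \<Sum>j<length ?e. (cmod (cinner (bs ! i) (?e ! j)))\<^sup>2)"
    using of_real_eq_iff by blast
  also have "\<dots> = (\<Sum>j<length ?e. \<Sum>i<length bs. (cmod (cinner (bs ! i) (?e ! j)))\<^sup>2)"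
    by (rule sum.swap)
  also have "\<dots> \<le> (\<Sum>j<length ?e. 1)"
  proof (rule sum_mono)
    fix j assume "j \<in> {..<length ?e}"
    then show "(\<Sum>i<length bs. (cmod (cinner (bs ! i) (?e ! j)))\<^sup>2) \<le> 1"
      using bessel[of "?e ! j"] one[of j] by simp
  qed
  finally show ?thesis by simp
qed

text \<open>A maximiser \<open>v\<close> of the Rayleigh quotient on the unit sphere of an invariant subspace is an
  eigenvector: with \<open>r\<close> the maximum, the form \<open>x \<mapsto> r * (norm x)\<^sup>2 - inner x (A x)\<close> is nonnegative and
  vanishes at \<open>v\<close>, so its derivative at \<open>v\<close> in the direction \<open>u = r *\<^sub>R v - A v\<close> vanishes; but this
  derivative is \<open>2 * (norm u)\<^sup>2\<close>.\<close>

lemma hermitian_eigenvector_in_orthogonal_complement: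
  fixes A :: "'a::fin_dim_complex_hilbert \<Rightarrow>\<^sub>L 'a"
  assumes herm: "hermitian_op A"
    and W: "W = {x. \<forall>b\<in>B. cinner b x = 0}"
    and inv: "\<And>x. x \<in> W \<Longrightarrow> A x \<in> W"
    and ne: "x \<in> W" "x \<noteq> 0"
  obtains v r where "v \<in> W" "norm v = 1" "A v = r *\<^sub>R v"
proof -
  have scW: "s *\<^sub>R y \<in> W" if "y \<in> W" for s y
    using that by (auto simp: W cinner_scaleR_right)
  have diffW: "y - y' \<in> W" if "y \<in> W" "y' \<in> W" for y y'
    using that by (auto simp: W cinner_diff_right)
  have "W = (\<Inter>b\<in>B. cinner b -` {0})" by (auto simp: W)
  moreover have "closed (cinner b -` {0})" for b :: 'a
    by (intro closed_vimage closed_singleton continuous_on_cinner continuous_intros)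
  ultimately have "closed W" by auto
  then have cpt: "compact (sphere 0 1 \<inter> W)"
    by (intro compact_Int_closed compact_unit_sphere)
  have "(1 / norm x) *\<^sub>R x \<in> sphere 0 1 \<inter> W" using ne scW by simp
  moreover have "continuous_on (sphere 0 1 \<inter> W) (\<lambda>x. inner x (A x))"
    by (intro continuous_intros)
  ultimately obtain v where v: "v \<in> sphere 0 1 \<inter> W"
    and max: "\<And>y. y \<in> sphere 0 1 \<inter> W \<Longrightarrow> inner y (A y) \<le> inner v (A v)"
    using continuous_attains_sup[OF cpt, of "\<lambda>x. inner x (A x)"] by blast
  define r where "r = inner v (A v)"
  have nonneg: "inner y (A y) \<le> r * (norm y)\<^sup>2" if "y \<in> W" for y
  proof (cases "y = 0")
    case False
    then have "inner ((1 / norm y) *\<^sub>R y) (A ((1 / norm y) *\<^sub>R y)) \<le> r"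
      unfolding r_def using that scW by (intro max) auto
    then show ?thesis
      using False by (simp add: blinfun.scaleR_right field_simps power2_eq_square)
  qed auto
  have sym: "inner (A y) y' = inner y (A y')" for y y'
    using herm by (simp add: inner_eq_Re_cinner hermitian_op_def)
  define u where "u = r *\<^sub>R v - A v"
  have uW: "u \<in> W" unfolding u_def using v inv scW diffW by auto
  define q where "q = r * (norm u)\<^sup>2 - inner u (A u)"
  have le: "2 * (norm u)\<^sup>2 \<le> s * q" if "s > 0" for s
  proof -
    have vv: "inner v v = 1" using v by (simp add: dot_square_norm)
    have uv: "inner u (A v) = inner v (A u)" using sym[of v u] by (simp only: inner_commute)
    have "inner (v - s *\<^sub>R u) (A (v - s *\<^sub>R u)) = r - 2 * s * inner v (A u) + s * s * inner u (A u)"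
      by (simp add: blinfun.diff_right blinfun.scaleR_right inner_diff_left inner_diff_right
          uv r_def algebra_simps)
    moreover have "(norm (v - s *\<^sub>R u))\<^sup>2 = 1 - 2 * s * inner v u + s * s * (norm u)\<^sup>2"
      unfolding power2_norm_eq_inner
      by (simp add: inner_diff_left inner_diff_right vv inner_commute[of u v] algebra_simps)
    moreover have "v - s *\<^sub>R u \<in> W" using v uW scW diffW by auto
    ultimately have "r - 2 * s * inner v (A u) + s * s * inner u (A u)
        \<le> r * (1 - 2 * s * inner v u + s * s * (norm u)\<^sup>2)"
      using nonneg[of "v - s *\<^sub>R u"] by simp
    then have "s * (2 * (r * inner v u - inner v (A u))) \<le> s * (s * q)"
      unfolding q_def by (simp add: algebra_simps)
    then have "2 * (r * inner v u - inner v (A u)) \<le> s * q"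
      using that by (simp only: mult_le_cancel_left_pos)
    also have "r * inner v u - inner v (A u) = (norm u)\<^sup>2"
    proof -
      have "inner u u = r * inner v u - inner (A v) u"
        by (subst (1) u_def) (simp add: inner_diff_left)
      then show ?thesis by (simp add: sym power2_norm_eq_inner)
    qed
    finally show ?thesis .
  qed
  have "u = 0"
  proof (rule ccontr)
    assume "u \<noteq> 0"
    \<comment> \<open>small enough for the quadratic term not to reach the linear one\<close>
    define s where "s = (norm u)\<^sup>2 / (\<bar>q\<bar> + 1)"
    have "s > 0" using \<open>u \<noteq> 0\<close> by (simp add: s_def)
    have "s * q \<le> (norm u)\<^sup>2 * (\<bar>q\<bar> / (\<bar>q\<bar> + 1))"
      unfolding s_def by (simp add: divide_right_mono mult_left_mono)
    also have "\<dots> \<le> (norm u)\<^sup>2" by (intro mult_right_le_one_le) auto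
    finally have "(norm u)\<^sup>2 \<le> 0" using le[OF \<open>s > 0\<close>] by linarith
    then show False using \<open>u \<noteq> 0\<close> by simp
  qed
  then have "A v = r *\<^sub>R v" by (simp add: u_def)
  with v that show thesis by auto
qed

definition eigenbasis ::
    "('a::complex_inner \<Rightarrow>\<^sub>L 'a) \<Rightarrow> 'a list \<Rightarrow> (nat \<Rightarrow> real) \<Rightarrow> bool" where
  "eigenbasis A bs l \<longleftrightarrow> orthonormal_basis bs \<and> (\<forall>i<length bs. A (bs ! i) = l i *\<^sub>R bs ! i)"

text \<open>The orthogonal complement of a list of eigenvectors is invariant; as long as it is nonzero it
  contains a further eigenvector, so an orthonormal list of eigenvectors of maximal length spans.\<close>

theorem spectral_theorem:
  fixes A :: "'a::fin_dim_complex_hilbert \<Rightarrow>\<^sub>L 'a"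
  assumes herm: "hermitian_op A"
  obtains bs l where "eigenbasis A bs l"
proof -
  define P where "P bs \<longleftrightarrow> orthonormal_list bs \<and> (\<forall>b\<in>set bs. \<exists>r::real. A b = r *\<^sub>R b)" for bs
  have "P []" by (simp add: P_def orthonormal_list_def)
  moreover have "\<forall>bs. P bs \<longrightarrow> length bs \<le> length (onb :: 'a list)"
    using orthonormal_list_length_le by (auto simp: P_def)
  ultimately obtain bs where bs: "P bs" and max: "\<And>cs. P cs \<Longrightarrow> length cs \<le> length bs"
    using ex_has_greatest_nat[of P "[]" length "Suc (length (onb :: 'a list))"] by fastforce
  have on: "orthonormal_list bs" and ev: "\<And>b. b \<in> set bs \<Longrightarrow> \<exists>r::real. A b = r *\<^sub>R b"
    using bs by (auto simp: P_def)
  define W where "W = {x. \<forall>b\<in>set bs. cinner b x = 0}"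
  have W0: "x = 0" if "x \<in> W" for x
  proof (rule ccontr)
    assume "x \<noteq> 0"
    have "A y \<in> W" if "y \<in> W" for y
    proof -
      have "cinner b (A y) = 0" if "b \<in> set bs" for b
      proof -
        obtain r :: real where "A b = r *\<^sub>R b" using ev[OF \<open>b \<in> set bs\<close>] by blast
        then have "cinner b (A y) = r *\<^sub>R cinner b y"
          using hermitian_opD[OF herm, of b y] by (simp add: cinner_scaleR_left)
        then show ?thesis using \<open>y \<in> W\<close> that by (simp add: W_def)
      qed
      then show ?thesis by (simp add: W_def)
    qed
    then obtain v r where v: "v \<in> W" "norm v = 1" "A v = r *\<^sub>R v"
      using hermitian_eigenvector_in_orthogonal_complement[OF herm W_def] \<open>x \<in> W\<close> \<open>x \<noteq> 0\<close> by blast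
    then have "P (bs @ [v])"
      using orthonormal_list_snoc[OF on] ev by (auto simp: P_def W_def)
    then show False using max by fastforce
  qed
  have "x \<in> cspan (set bs)" for x
  proof -
    define p where "p = (\<Sum>i<length bs. cinner (bs ! i) x *\<^sub>C bs ! i)"
    have "x - p \<in> W" using orthogonal_projection[OF on] by (simp add: W_def p_def)
    from W0[OF this] have "x = p" by simp
    moreover have "p \<in> cspan (set bs)"
      unfolding p_def
      by (intro complex_vector.span_sum complex_vector.span_scale complex_vector.span_base) simp
    ultimately show ?thesis by (simp only:)
  qed
  then have "orthonormal_basis bs" using on by (auto simp: orthonormal_basis_def orthonormal_list_def)
  moreover have "\<exists>l. \<forall>i. i < length bs \<longrightarrow> A (bs ! i) = l i *\<^sub>R bs ! i"
    using ev by (intro choice) auto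
  ultimately show thesis using that by (force simp: eigenbasis_def)
qed

section \<open>Operators that are diagonal in an orthonormal basis\<close>

lemma basis_expansion:
  assumes "orthonormal_basis bs"
  shows "x = (\<Sum>i<length bs. cinner (bs ! i) x *\<^sub>C bs ! i)"
  using assms by (intro orthonormal_expansion) (auto simp: orthonormal_basis_def)

lemma cinner_basis:
  assumes "orthonormal_basis bs" "i < length bs" "j < length bs"
  shows "cinner (bs ! i) (bs ! j) = (if i = j then 1 else 0)"
  using assms by (auto simp: orthonormal_basis_def)

lemma norm_basis: "orthonormal_basis bs \<Longrightarrow> i < length bs \<Longrightarrow> norm (bs ! i) = 1"
  unfolding norm_eq_1_cinner by (simp add: cinner_basis)

lemma norm_sq_basis:
  assumes "orthonormal_basis bs"
  shows "(norm x)\<^sup>2 = (\<Sum>i<length bs. (cmod (cinner (bs ! i) x))\<^sup>2)"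
proof -
  have "complex_of_real ((norm x)\<^sup>2) = (\<Sum>i<length bs. cinner x (bs ! i) * cinner (bs ! i) x)"
    unfolding cinner_self[symmetric] by (rule parseval[OF assms])
  also have "\<dots> = (\<Sum>i<length bs. complex_of_real ((cmod (cinner (bs ! i) x))\<^sup>2))"
    unfolding cinner_commute[of x] by (intro sum.cong refl) (simp only: complex_norm_square mult.commute)
  finally show ?thesis unfolding of_real_sum[symmetric] of_real_eq_iff .
qed

lemma clinear_op_add: "clinear_op A \<Longrightarrow> clinear_op B \<Longrightarrow> clinear_op (A + B)"
  by (rule clinear_opI) (simp add: clinear_op_scaleC blinfun.add_left scaleC_add_right)

lemma clinear_op_diff: "clinear_op A \<Longrightarrow> clinear_op B \<Longrightarrow> clinear_op (A - B)"
  by (rule clinear_opI)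
    (simp add: clinear_op_scaleC blinfun.diff_left complex_vector.scale_right_diff_distrib)

lemma clinear_op_compose: "clinear_op A \<Longrightarrow> clinear_op B \<Longrightarrow> clinear_op (A o\<^sub>L B)"
  by (rule clinear_opI) (simp add: clinear_op_scaleC)

lemma clinear_op_id: "clinear_op id_blinfun"
  by (rule clinear_opI) simp

lemma clinear_op_scalar: "clinear_op (scalar_op z)"
  by (rule clinear_opI) (simp add: scaleC_scaleC mult.commute)

lemma clinear_op_apply_expansion:
  assumes "clinear_op A" "orthonormal_basis bs"
  shows "A x = (\<Sum>i<length bs. cinner (bs ! i) x *\<^sub>C A (bs ! i))"
proof -
  interpret Vector_Spaces.linear scaleC scaleC "blinfun_apply A"
    using assms(1) by (simp add: clinear_op_def)
  have "A x = A (\<Sum>i<length bs. cinner (bs ! i) x *\<^sub>C bs ! i)"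
    using basis_expansion[OF assms(2), of x] by (rule arg_cong)
  then show ?thesis by (simp only: sum scale)
qed

lemma clinear_op_eqI:
  assumes "orthonormal_basis bs" "clinear_op A" "clinear_op B"
    and "\<And>i. i < length bs \<Longrightarrow> A (bs ! i) = B (bs ! i)"
  shows "A = B"
proof (rule blinfun_eqI)
  fix x
  show "A x = B x"
    unfolding clinear_op_apply_expansion[OF assms(2,1), of x]
      clinear_op_apply_expansion[OF assms(3,1), of x]
    by (intro sum.cong refl) (simp add: assms(4))
qed

definition rank_one :: "'a::complex_inner \<Rightarrow> 'b::complex_inner \<Rightarrow> 'b \<Rightarrow>\<^sub>L 'a" where
  "rank_one w u = Blinfun (\<lambda>y. cinner u y *\<^sub>C w)"

lemma rank_one_apply: "rank_one w u y = cinner u y *\<^sub>C w"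
proof -
  have "bounded_linear (\<lambda>y. cinner u y *\<^sub>C w)"
    by (intro bounded_linear_compose[OF bounded_bilinear.bounded_linear_left[OF bounded_bilinear_scaleC]]
        bounded_bilinear.bounded_linear_right[OF bounded_bilinear_cinner])
  then show ?thesis by (simp add: rank_one_def bounded_linear_Blinfun_apply)
qed

lemma bounded_linear_rank_one: "bounded_linear (\<lambda>u. rank_one w u)"
proof (rule bounded_linear_intro[where K = "norm w"])
  fix u v r
  show "rank_one w (u + v) = rank_one w u + rank_one w v"
    by (rule blinfun_eqI) (simp add: rank_one_apply blinfun.add_left cinner_add_left scaleC_add_left)
  show "rank_one w (r *\<^sub>R u) = r *\<^sub>R rank_one w u"
    by (rule blinfun_eqI)
      (simp add: rank_one_apply blinfun.scaleR_left cinner_scaleR_left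
        bounded_bilinear.scaleR_left[OF bounded_bilinear_scaleC])
  show "norm (rank_one w u) \<le> norm u * norm w"
  proof (rule norm_blinfun_bound)
    fix y
    have "norm (rank_one w u y) \<le> (norm u * norm y) * norm w"
      unfolding rank_one_apply norm_scaleC by (intro mult_right_mono cmod_cinner_le) simp
    then show "norm (rank_one w u y) \<le> norm u * norm w * norm y" by (simp only: mult_ac)
  qed simp
qed

lemma hermitian_rank_one: "hermitian_op (rank_one b b)"
  unfolding hermitian_op_def
proof (intro allI)
  fix x y
  show "cinner (rank_one b b x) y = cinner x (rank_one b b y)"
    unfolding rank_one_apply cinner_scaleC_left cinner_scaleC_right
    by (simp flip: cinner_commute)
qed

lemma hermitian_op_diff: "hermitian_op A \<Longrightarrow> hermitian_op B \<Longrightarrow> hermitian_op (A - B)"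
  by (simp add: hermitian_op_def blinfun.diff_left cinner_diff_left cinner_diff_right)

lemma hermitian_op_scaleR: "hermitian_op A \<Longrightarrow> hermitian_op (r *\<^sub>R A)"
  by (simp add: hermitian_op_def blinfun.scaleR_left cinner_scaleR_left cinner_scaleR_right)

lemma hermitian_op_sum: "(\<And>i. i \<in> I \<Longrightarrow> hermitian_op (f i)) \<Longrightarrow> hermitian_op (\<Sum>i\<in>I. f i)"
  by (simp add: hermitian_op_def blinfun.sum_left cinner_sum_left cinner_sum_right)

definition diag_op :: "'a::complex_inner list \<Rightarrow> (nat \<Rightarrow> real) \<Rightarrow> 'a \<Rightarrow>\<^sub>L 'a" where
  "diag_op bs f = (\<Sum>i<length bs. f i *\<^sub>R rank_one (bs ! i) (bs ! i))"

lemma hermitian_diag_op: "hermitian_op (diag_op bs f)"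
  unfolding diag_op_def by (intro hermitian_op_sum hermitian_op_scaleR hermitian_rank_one)

lemma diag_op_apply_basis:
  assumes "orthonormal_basis bs" "j < length bs"
  shows "diag_op bs f (bs ! j) = f j *\<^sub>R bs ! j"
proof -
  have "diag_op bs f (bs ! j) = (\<Sum>i<length bs. f i *\<^sub>R (cinner (bs ! i) (bs ! j) *\<^sub>C bs ! i))"
    by (simp add: diag_op_def blinfun.sum_left blinfun.scaleR_left rank_one_apply)
  also have "\<dots> = (\<Sum>i<length bs. if i = j then f j *\<^sub>R bs ! j else 0)"
    using assms by (intro sum.cong refl) (simp add: cinner_basis scaleC_one)
  finally show ?thesis using assms by simp
qed

lemma eigenbasis_diag_op: "orthonormal_basis bs \<Longrightarrow> eigenbasis (diag_op bs f) bs f"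
  by (simp add: eigenbasis_def diag_op_apply_basis)

lemma cinner_eigenbasis:
  assumes "hermitian_op A" "eigenbasis A bs l" "i < length bs"
  shows "cinner (bs ! i) (A x) = l i *\<^sub>R cinner (bs ! i) x"
  using assms by (simp add: hermitian_opD[symmetric] eigenbasis_def cinner_scaleR_left)

section \<open>Lower bounds and the Sylvester equation\<close>

definition coercive :: "('a::complex_inner \<Rightarrow>\<^sub>L 'a) \<Rightarrow> real \<Rightarrow> bool" where
  "coercive A c \<longleftrightarrow> (\<forall>x. c * (norm x)\<^sup>2 \<le> Re (cinner x (A x)))"

lemma positive_op_iff:
  fixes A :: "'a::fin_dim_complex_hilbert \<Rightarrow>\<^sub>L 'a"
  shows "positive_op A \<longleftrightarrow> hermitian_op A \<and> coercive A 0"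
  by (auto simp: positive_op_def hermitian_op_iff coercive_def)

lemma coercive_mono: "coercive A c \<Longrightarrow> d \<le> c \<Longrightarrow> coercive A d"
  unfolding coercive_def by (meson mult_right_mono order_trans zero_le_power2)

lemma coercive_eigenbasis_iff:
  assumes "hermitian_op A" "eigenbasis A bs l"
  shows "coercive A c \<longleftrightarrow> (\<forall>i<length bs. c \<le> l i)"
proof
  have on: "orthonormal_basis bs" using assms(2) by (simp add: eigenbasis_def)
  show "\<forall>i<length bs. c \<le> l i" if "coercive A c"
  proof (intro allI impI)
    fix i assume i: "i < length bs"
    have "c * (norm (bs ! i))\<^sup>2 \<le> Re (cinner (bs ! i) (A (bs ! i)))"
      using that by (simp add: coercive_def)
    then show "c \<le> l i"
      unfolding cinner_eigenbasis[OF assms i] using on i by (simp add: norm_basis cinner_basis)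
  qed
  show "coercive A c" if c: "\<forall>i<length bs. c \<le> l i"
    unfolding coercive_def
  proof
    fix x
    have "cinner x (A x) = (\<Sum>i<length bs. cinner x (bs ! i) * cinner (bs ! i) (A x))"
      by (rule parseval[OF on])
    also have "\<dots> = (\<Sum>i<length bs. complex_of_real (l i * (cmod (cinner (bs ! i) x))\<^sup>2))"
      unfolding cinner_commute[of x "bs ! _"] of_real_mult complex_norm_square
      by (intro sum.cong refl) (simp add: cinner_eigenbasis[OF assms] scaleR_conv_of_real mult_ac)
    finally have "Re (cinner x (A x)) = (\<Sum>i<length bs. l i * (cmod (cinner (bs ! i) x))\<^sup>2)"
      unfolding of_real_sum[symmetric] by simp
    also have "\<dots> \<ge> (\<Sum>i<length bs. c * (cmod (cinner (bs ! i) x))\<^sup>2)"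
      using c by (intro sum_mono mult_right_mono) auto
    finally show "c * (norm x)\<^sup>2 \<le> Re (cinner x (A x))"
      unfolding norm_sq_basis[OF on, of x] sum_distrib_left .
  qed
qed

lemma norm_le_eigenbasis:
  assumes "hermitian_op A" "eigenbasis A bs l"
    and "\<And>i. i < length bs \<Longrightarrow> \<bar>l i\<bar> \<le> c" and "0 \<le> c"
  shows "norm A \<le> c"
proof (rule norm_blinfun_bound[OF \<open>0 \<le> c\<close>])
  fix x
  have on: "orthonormal_basis bs" using assms(2) by (simp add: eigenbasis_def)
  have "(norm (A x))\<^sup>2 = (\<Sum>i<length bs. (l i)\<^sup>2 * (cmod (cinner (bs ! i) x))\<^sup>2)"
    unfolding norm_sq_basis[OF on, of "A x"]
    by (intro sum.cong refl) (simp add: cinner_eigenbasis[OF assms(1,2)] power_mult_distrib)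
  also have "\<dots> \<le> (\<Sum>i<length bs. c\<^sup>2 * (cmod (cinner (bs ! i) x))\<^sup>2)"
  proof (intro sum_mono mult_right_mono zero_le_power2)
    fix i assume "i \<in> {..<length bs}"
    then have "\<bar>l i\<bar>\<^sup>2 \<le> c\<^sup>2" by (intro power_mono assms(3)) auto
    then show "(l i)\<^sup>2 \<le> c\<^sup>2" by simp
  qed
  also have "\<dots> = (c * norm x)\<^sup>2"
    unfolding power_mult_distrib norm_sq_basis[OF on, of x] sum_distrib_left ..
  finally show "norm (A x) \<le> c * norm x"
    by (rule power2_le_imp_le) (simp add: \<open>0 \<le> c\<close>)
qed

text \<open>Testing \<open>S Y + Y T\<close> on a unit eigenvector \<open>v\<close> of \<open>Y\<close> with eigenvalue \<open>r\<close> gives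
  \<open>r * (inner v (S v) + inner v (T v))\<close>, so every eigenvalue of \<open>Y\<close> is controlled by
  the right-hand side of the Sylvester equation.\<close>

theorem sylvester_estimate:
  fixes S T Y :: "'a::fin_dim_complex_hilbert \<Rightarrow>\<^sub>L 'a"
  assumes "hermitian_op Y" "coercive S a" "coercive T b" "0 < a + b"
  shows "(a + b) * norm Y \<le> norm ((S o\<^sub>L Y) + (Y o\<^sub>L T))"
proof -
  let ?R = "(S o\<^sub>L Y) + (Y o\<^sub>L T)"
  obtain bs l where eb: "eigenbasis Y bs l" using spectral_theorem[OF assms(1)] .
  then have on: "orthonormal_basis bs" by (simp add: eigenbasis_def)
  have "\<bar>l i\<bar> \<le> norm ?R / (a + b)" if i: "i < length bs" for i
  proof -
    let ?v = "bs ! i"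
    have Yv: "Y ?v = l i *\<^sub>R ?v" and nv: "norm ?v = 1"
      using eb i norm_basis[OF on i] by (simp_all add: eigenbasis_def)
    have ge: "a + b \<le> Re (cinner ?v (S ?v)) + Re (cinner ?v (T ?v))"
      using assms(2,3)[unfolded coercive_def, THEN spec, of ?v] nv by simp
    have "cinner ?v (?R ?v) = cinner ?v (S (Y ?v)) + cinner ?v (Y (T ?v))"
      by (simp add: blinfun.add_left cinner_add_right)
    also have "cinner ?v (Y (T ?v)) = l i *\<^sub>R cinner ?v (T ?v)"
      by (rule cinner_eigenbasis[OF assms(1) eb i])
    also have "cinner ?v (S (Y ?v)) = l i *\<^sub>R cinner ?v (S ?v)"
      by (simp add: Yv blinfun.scaleR_right cinner_scaleR_right)
    finally have "Re (cinner ?v (?R ?v)) = l i * (Re (cinner ?v (S ?v)) + Re (cinner ?v (T ?v)))"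
      by (simp add: distrib_left)
    then have "\<bar>l i\<bar> * (Re (cinner ?v (S ?v)) + Re (cinner ?v (T ?v))) = \<bar>Re (cinner ?v (?R ?v))\<bar>"
      using ge assms(4) by (simp add: abs_mult)
    also have "\<dots> \<le> norm ?v * norm (?R ?v)"
      using abs_Re_le_cmod cmod_cinner_le by (rule order_trans)
    also have "\<dots> \<le> norm ?R" using norm_blinfun[of ?R ?v] nv by simp
    finally have "\<bar>l i\<bar> * (a + b) \<le> norm ?R"
      using mult_left_mono[OF ge, of "\<bar>l i\<bar>"] by simp
    then show ?thesis using assms(4) by (simp add: pos_le_divide_eq)
  qed
  then have "norm Y \<le> norm ?R / (a + b)"
    using norm_le_eigenbasis[OF assms(1) eb] assms(4) by simp
  then show ?thesis using assms(4) by (simp add: pos_le_divide_eq mult.commute)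
qed

lemma hadjoint_add:
  fixes A B :: "'a::fin_dim_complex_hilbert \<Rightarrow>\<^sub>L 'b::complex_inner"
  assumes "clinear_op A" "clinear_op B"
  shows "(A + B)\<^sup>\<dagger> = A\<^sup>\<dagger> + B\<^sup>\<dagger>"
  by (rule hadjoint_unique)
    (simp add: blinfun.add_left cinner_add_left cinner_add_right hadjoint[OF assms(1)] hadjoint[OF assms(2)])

lemma cinner_hadjoint_left:
  fixes A :: "'a::fin_dim_complex_hilbert \<Rightarrow>\<^sub>L 'b::complex_inner"
  assumes "clinear_op A"
  shows "cinner ((A\<^sup>\<dagger>) y) x = cinner y (A x)"
  using hadjoint[OF assms, of x y] by (metis cinner_commute)

lemma hadjoint_compose:
  fixes A :: "'b::fin_dim_complex_hilbert \<Rightarrow>\<^sub>L 'c::complex_inner"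
    and B :: "'a::fin_dim_complex_hilbert \<Rightarrow>\<^sub>L 'b"
  assumes "clinear_op A" "clinear_op B"
  shows "(A o\<^sub>L B)\<^sup>\<dagger> = B\<^sup>\<dagger> o\<^sub>L A\<^sup>\<dagger>"
  by (rule hadjoint_unique) (simp add: hadjoint[OF assms(1)] hadjoint[OF assms(2)])

text \<open>In an eigenbasis of \<open>S\<close> the solution is the sum over the eigenvalues \<open>r\<close> of
  \<open>inverse (S + r)\<close> applied to \<open>R\<close> composed with the eigenprojection; its Hermitian part solves
  the equation as well.\<close>

lemma sylvester_solution:
  fixes S R :: "'a::fin_dim_complex_hilbert \<Rightarrow>\<^sub>L 'a"
  assumes "hermitian_op S" "coercive S c" "0 < c" "hermitian_op R"
  obtains D where "hermitian_op D" "(S o\<^sub>L D) + (D o\<^sub>L S) = R"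
proof -
  obtain bs l where eb: "eigenbasis S bs l" using spectral_theorem[OF assms(1)] .
  then have on: "orthonormal_basis bs" by (simp add: eigenbasis_def)
  have Sb: "S (bs ! i) = l i *\<^sub>R bs ! i" if "i < length bs" for i
    using eb that by (simp add: eigenbasis_def)
  have pos: "0 < l i" if "i < length bs" for i
    using coercive_eigenbasis_iff[OF assms(1) eb, of c] assms(2,3) that by force
  have lin: "clinear_op S" "clinear_op R" using assms(1,4) by (simp_all add: hermitian_imp_clinear)
  \<comment> \<open>\<open>V j\<close> is the inverse of \<open>S + l j\<close>\<close>
  define V where "V j = diag_op bs (\<lambda>i. 1 / (l i + l j))" for j
  have V: "S (V j x) + l j *\<^sub>R V j x = x" if j: "j < length bs" for j x
  proof -
    have "(S o\<^sub>L V j) + l j *\<^sub>R V j = id_blinfun"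
    proof (rule clinear_op_eqI[OF on])
      have "hermitian_op (l j *\<^sub>R V j)" unfolding V_def by (intro hermitian_op_scaleR hermitian_diag_op)
      moreover have "hermitian_op (V j)" unfolding V_def by (rule hermitian_diag_op)
      ultimately show "clinear_op ((S o\<^sub>L V j) + l j *\<^sub>R V j)"
        by (intro clinear_op_add clinear_op_compose hermitian_imp_clinear assms(1))
      fix i assume i: "i < length bs"
      have "((S o\<^sub>L V j) + l j *\<^sub>R V j) (bs ! i) = (l i / (l i + l j) + l j / (l i + l j)) *\<^sub>R bs ! i"
        by (simp add: V_def diag_op_apply_basis[OF on i] blinfun.add_left blinfun.scaleR_left
            blinfun.scaleR_right Sb[OF i] add_divide_distrib scaleR_left_distrib)
      then show "((S o\<^sub>L V j) + l j *\<^sub>R V j) (bs ! i) = id_blinfun (bs ! i)"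
        using pos[OF i] pos[OF j] by (simp add: add_divide_distrib[symmetric])
    qed (rule clinear_op_id)
    from arg_cong[OF this, of "\<lambda>A. A x"] show ?thesis
      by (simp add: blinfun.add_left blinfun.scaleR_left)
  qed
  define D where "D = (\<Sum>j<length bs. V j o\<^sub>L R o\<^sub>L rank_one (bs ! j) (bs ! j))"
  have "clinear_op (rank_one (bs ! j) (bs ! j))" "clinear_op (V j)" for j
    by (simp_all add: hermitian_imp_clinear hermitian_rank_one V_def hermitian_diag_op)
  then have "clinear_op (V j o\<^sub>L R o\<^sub>L rank_one (bs ! j) (bs ! j))" for j
    using lin by (intro clinear_op_compose)
  then have linD: "clinear_op D"
    by (intro clinear_opI) (simp add: D_def blinfun.sum_left clinear_op_scaleC complex_vector.scale_sum_right
        del: blinfun_apply_blinfun_compose)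
  have Db: "D (bs ! i) = V i (R (bs ! i))" if i: "i < length bs" for i
  proof -
    have "D (bs ! i) = (\<Sum>j<length bs. V j (R (cinner (bs ! j) (bs ! i) *\<^sub>C bs ! j)))"
      by (simp add: D_def blinfun.sum_left rank_one_apply)
    also have "\<dots> = (\<Sum>j<length bs. if j = i then V i (R (bs ! i)) else 0)"
      using i by (intro sum.cong refl) (simp add: cinner_basis[OF on] scaleC_one)
    finally show ?thesis using i by simp
  qed
  have D: "(S o\<^sub>L D) + (D o\<^sub>L S) = R"
  proof (rule clinear_op_eqI[OF on])
    show "clinear_op ((S o\<^sub>L D) + (D o\<^sub>L S))"
      using linD lin by (intro clinear_op_add clinear_op_compose)
    fix i assume i: "i < length bs"
    show "((S o\<^sub>L D) + (D o\<^sub>L S)) (bs ! i) = R (bs ! i)"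
      by (simp add: blinfun.add_left Sb[OF i] blinfun.scaleR_right Db[OF i] V[OF i])
  qed (rule lin)
  have adjS: "S\<^sup>\<dagger> = S" and adjR: "R\<^sup>\<dagger> = R" using assms(1,4) by (simp_all add: hermitian_op_adjoint)
  have "R = ((S o\<^sub>L D) + (D o\<^sub>L S))\<^sup>\<dagger>" by (simp only: D adjR)
  also have "\<dots> = (D\<^sup>\<dagger> o\<^sub>L S) + (S o\<^sub>L D\<^sup>\<dagger>)"
    using lin linD by (simp add: hadjoint_add hadjoint_compose clinear_op_compose adjS)
  finally have D': "(S o\<^sub>L D\<^sup>\<dagger>) + (D\<^sup>\<dagger> o\<^sub>L S) = R" by (simp only: add.commute)
  define H where "H = (1/2) *\<^sub>R (D + D\<^sup>\<dagger>)"
  have "hermitian_op (D + D\<^sup>\<dagger>)"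
    unfolding hermitian_op_def blinfun.add_left cinner_add_left cinner_add_right
    by (simp add: hadjoint[OF linD] cinner_hadjoint_left[OF linD])
  then have "hermitian_op H" unfolding H_def by (rule hermitian_op_scaleR)
  moreover have "(S o\<^sub>L H) + (H o\<^sub>L S) = (1/2) *\<^sub>R (((S o\<^sub>L D) + (D o\<^sub>L S)) + ((S o\<^sub>L D\<^sup>\<dagger>) + (D\<^sup>\<dagger> o\<^sub>L S)))"
    by (rule blinfun_eqI)
      (simp add: H_def blinfun.add_left blinfun.scaleR_left blinfun.add_right blinfun.scaleR_right
        scaleR_add_right)
  then have "(S o\<^sub>L H) + (H o\<^sub>L S) = R" unfolding D D' by (simp add: scaleR_2[symmetric])
  ultimately show thesis by (rule that)
qed

section \<open>Inverses and positive square roots\<close>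

lemma inverse_op_eqI:
  assumes "A o\<^sub>L B = id_blinfun" "B o\<^sub>L A = id_blinfun"
  shows "inverse_op A = B"
  unfolding inverse_op_def
proof (rule the_equality)
  fix C assume C: "A o\<^sub>L C = id_blinfun \<and> C o\<^sub>L A = id_blinfun"
  have "C y = B y" for y
  proof -
    have "C (A (B y)) = B y"
      using arg_cong[OF conjunct2[OF C], of "\<lambda>F. F (B y)"] by simp
    moreover have "A (B y) = y"
      using arg_cong[OF assms(1), of "\<lambda>F. F y"] by simp
    ultimately show ?thesis by simp
  qed
  then show "C = B" by (rule blinfun_eqI)
qed (use assms in simp)

text \<open>In an eigenbasis the inverse has the reciprocal eigenvalues.\<close>

lemma hermitian_inverse:
  fixes S :: "'a::fin_dim_complex_hilbert \<Rightarrow>\<^sub>L 'a"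
  assumes "hermitian_op S" "0 < c"
    and gap: "\<And>v r. S v = r *\<^sub>R v \<Longrightarrow> v \<noteq> 0 \<Longrightarrow> c \<le> \<bar>r\<bar>"
  shows "S o\<^sub>L inverse_op S = id_blinfun" "inverse_op S o\<^sub>L S = id_blinfun"
    "hermitian_op (inverse_op S)" "norm (inverse_op S) \<le> 1 / c" "invertible_op S"
proof -
  obtain bs l where eb: "eigenbasis S bs l" using spectral_theorem[OF assms(1)] .
  then have on: "orthonormal_basis bs" by (simp add: eigenbasis_def)
  have lc: "c \<le> \<bar>l i\<bar>" if "i < length bs" for i
    using eb that gap[of "bs ! i" "l i"] norm_basis[OF on that] by (force simp: eigenbasis_def)
  define T where "T = diag_op bs (\<lambda>i. 1 / l i)"
  have T: "hermitian_op T" "eigenbasis T bs (\<lambda>i. 1 / l i)"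
    unfolding T_def by (rule hermitian_diag_op, rule eigenbasis_diag_op[OF on])
  have lin: "clinear_op S" "clinear_op T" using assms(1) T(1) by (simp_all add: hermitian_imp_clinear)
  have nz: "l i \<noteq> 0" if "i < length bs" for i using lc[OF that] \<open>0 < c\<close> by auto
  have ST: "S o\<^sub>L T = id_blinfun"
    using eb T(2) nz
    by (intro clinear_op_eqI[OF on clinear_op_compose[OF lin] clinear_op_id])
      (simp add: eigenbasis_def blinfun.scaleR_right)
  have TS: "T o\<^sub>L S = id_blinfun"
    using eb T(2) nz
    by (intro clinear_op_eqI[OF on clinear_op_compose[OF lin(2,1)] clinear_op_id])
      (simp add: eigenbasis_def blinfun.scaleR_right)
  have inv: "inverse_op S = T" by (rule inverse_op_eqI[OF ST TS])
  show "S o\<^sub>L inverse_op S = id_blinfun" "inverse_op S o\<^sub>L S = id_blinfun" "hermitian_op (inverse_op S)"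
    unfolding inv by (rule ST TS T(1))+
  show "invertible_op S" using ST TS by (auto simp: invertible_op_def)
  show "norm (inverse_op S) \<le> 1 / c"
    unfolding inv
  proof (rule norm_le_eigenbasis[OF T])
    fix i assume i: "i < length bs"
    show "\<bar>1 / l i\<bar> \<le> 1 / c" using lc[OF i] \<open>0 < c\<close> by (simp add: frac_le)
  qed (use \<open>0 < c\<close> in simp)
qed

lemma coercive_eigenvalue_ge:
  assumes "coercive S c" "S v = r *\<^sub>R v" "v \<noteq> 0"
  shows "c \<le> r"
proof -
  have "c * (norm v)\<^sup>2 \<le> Re (cinner v (S v))" using assms(1) by (simp add: coercive_def)
  also have "\<dots> = r * (norm v)\<^sup>2" by (simp add: assms(2) cinner_scaleR_right Re_cinner_self)
  finally show ?thesis using assms(3) by simp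
qed

text \<open>For two square roots \<open>S\<close> and \<open>T\<close> of \<open>P\<close> one has \<open>S (S - T) + (S - T) T = 0\<close>, so uniqueness is
  an instance of the Sylvester estimate.\<close>

lemma sqrt_op:
  fixes P :: "'a::fin_dim_complex_hilbert \<Rightarrow>\<^sub>L 'a"
  assumes "hermitian_op P" "coercive P (m\<^sup>2)" "0 < m"
  shows "hermitian_op (sqrt_op P)" "coercive (sqrt_op P) m" "sqrt_op P o\<^sub>L sqrt_op P = P"
    "\<And>T. positive_op T \<Longrightarrow> T o\<^sub>L T = P \<Longrightarrow> T = sqrt_op P"
proof -
  obtain bs l where eb: "eigenbasis P bs l" using spectral_theorem[OF assms(1)] .
  then have on: "orthonormal_basis bs" by (simp add: eigenbasis_def)
  have l: "m\<^sup>2 \<le> l i" if "i < length bs" for i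
    using coercive_eigenbasis_iff[OF assms(1) eb] assms(2) that by blast
  define S where "S = diag_op bs (\<lambda>i. sqrt (l i))"
  have S: "hermitian_op S" "eigenbasis S bs (\<lambda>i. sqrt (l i))"
    unfolding S_def by (rule hermitian_diag_op, rule eigenbasis_diag_op[OF on])
  have Sm: "coercive S m"
    using coercive_eigenbasis_iff[OF S] l assms(3) by (simp add: real_le_rsqrt)
  have SS: "S o\<^sub>L S = P"
  proof (rule clinear_op_eqI[OF on])
    fix i assume i: "i < length bs"
    have "0 \<le> l i" using l[OF i] by (rule order_trans[OF zero_le_power2])
    then show "(S o\<^sub>L S) (bs ! i) = P (bs ! i)"
      using eb S(2) i by (simp add: eigenbasis_def blinfun.scaleR_right)
  qed (use S(1) assms(1) in \<open>simp_all add: clinear_op_compose hermitian_imp_clinear\<close>)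
  have uniq: "T = S" if T: "positive_op T" "T o\<^sub>L T = P" for T
  proof -
    have T': "hermitian_op T" "coercive T 0" using T(1) by (simp_all add: positive_op_iff)
    have "(S o\<^sub>L (S - T)) + ((S - T) o\<^sub>L T) = (S o\<^sub>L S) - (T o\<^sub>L T)"
      by (rule blinfun_eqI) (simp add: blinfun.diff_left blinfun.add_left blinfun.diff_right)
    also have "\<dots> = 0" by (simp only: SS T(2) diff_self)
    finally have "(m + 0) * norm (S - T) \<le> norm (0 :: 'a \<Rightarrow>\<^sub>L 'a)"
      using sylvester_estimate[OF hermitian_op_diff[OF S(1) T'(1)] Sm T'(2)] assms(3) by simp
    then have "m * norm (S - T) \<le> 0" by simp
    then show "T = S" using assms(3) by (simp add: mult_le_0_iff)
  qed
  have pos: "positive_op S" using S(1) coercive_mono[OF Sm, of 0] assms(3) by (simp add: positive_op_iff)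
  have eq: "sqrt_op P = S"
    unfolding sqrt_op_def
  proof (rule the_equality)
    show "T = S" if "positive_op T \<and> T o\<^sub>L T = P" for T
      using uniq[of T] that by blast
  qed (simp add: SS pos)
  show "hermitian_op (sqrt_op P)" "coercive (sqrt_op P) m" "sqrt_op P o\<^sub>L sqrt_op P = P"
    unfolding eq by (rule S(1) Sm SS)+
  show "T = sqrt_op P" if "positive_op T" "T o\<^sub>L T = P" for T
    unfolding eq using uniq[OF that] .
qed

section \<open>Continuously differentiable families of operators\<close>

lemma has_vector_derivative_iff_slope:
  "(f has_vector_derivative D) (at t) \<longleftrightarrow> ((\<lambda>s. (f s - f t) /\<^sub>R (s - t)) \<longlongrightarrow> D) (at t)"
proof -
  have "norm (f s - f t - (s - t) *\<^sub>R D) / norm (s - t) = norm ((f s - f t) /\<^sub>R (s - t) - D)"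
    if "s \<noteq> t" for s
  proof -
    have "f s - f t - (s - t) *\<^sub>R D = (s - t) *\<^sub>R ((f s - f t) /\<^sub>R (s - t) - D)"
      using that by (simp add: scaleR_diff_right)
    then show ?thesis using that by (simp add: abs_mult)
  qed
  then have "((\<lambda>s. norm (f s - f t - (s - t) *\<^sub>R D) / norm (s - t)) \<longlongrightarrow> 0) (at t) \<longleftrightarrow>
      ((\<lambda>s. norm ((f s - f t) /\<^sub>R (s - t) - D)) \<longlongrightarrow> 0) (at t)"
    by (intro Lim_cong_within) auto
  also have "\<dots> \<longleftrightarrow> ((\<lambda>s. (f s - f t) /\<^sub>R (s - t)) \<longlongrightarrow> D) (at t)"
    by (subst tendsto_norm_zero_iff) (rule LIM_zero_iff)
  finally show ?thesis
    by (simp add: has_vector_derivative_def has_derivative_iff_norm bounded_linear_scaleR_left)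
qed

lemma C1_bounded_linear:
  assumes "bounded_linear L" "F C1_differentiable_on S"
  shows "(\<lambda>t. L (F t)) C1_differentiable_on S"
proof -
  obtain D where "\<And>t. t \<in> S \<Longrightarrow> (F has_vector_derivative D t) (at t)" "continuous_on S D"
    using assms(2) by (auto simp: C1_differentiable_on_def)
  then show ?thesis
    unfolding C1_differentiable_on_def
    by (intro exI[of _ "\<lambda>t. L (D t)"] conjI ballI)
      (auto intro: bounded_linear.has_vector_derivative[OF assms(1)] bounded_linear.continuous_on[OF assms(1)])
qed

lemma C1_bounded_bilinear:
  assumes "bounded_bilinear B" "F C1_differentiable_on S" "G C1_differentiable_on S"
  shows "(\<lambda>t. B (F t) (G t)) C1_differentiable_on S"
proof -
  obtain D where D: "\<And>t. t \<in> S \<Longrightarrow> (F has_vector_derivative D t) (at t)" "continuous_on S D"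
    using assms(2) by (auto simp: C1_differentiable_on_def)
  obtain E where E: "\<And>t. t \<in> S \<Longrightarrow> (G has_vector_derivative E t) (at t)" "continuous_on S E"
    using assms(3) by (auto simp: C1_differentiable_on_def)
  have "continuous_on S F" "continuous_on S G"
    using assms(2,3) by (auto intro: C1_differentiable_imp_continuous_on)
  then show ?thesis
    unfolding C1_differentiable_on_def
    by (intro exI[of _ "\<lambda>t. B (F t) (E t) + B (D t) (G t)"] conjI ballI continuous_on_add
        bounded_bilinear.has_vector_derivative[OF assms(1)]
        bounded_bilinear.continuous_on[OF assms(1)] D E)
qed

text \<open>Closed linear conditions on a family of operators, such as being Hermitian, pass to its derivative.\<close>

lemma vector_derivative_in_kernel:
  assumes "bounded_linear L" "\<And>s. L (F s) = 0" "(F has_vector_derivative D) (at t)"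
  shows "L D = 0"
proof -
  have "((\<lambda>s. L (F s)) has_vector_derivative L D) (at t)"
    using assms(1,3) by (rule bounded_linear.has_vector_derivative)
  then have "((\<lambda>s. 0) has_vector_derivative L D) (at t)" by (simp add: assms(2))
  then show ?thesis by (rule vector_derivative_unique_at) simp
qed

lemma hermitian_vector_derivative:
  assumes "\<And>s. hermitian_op (F s)" "(F has_vector_derivative D) (at t)"
  shows "hermitian_op D"
  unfolding hermitian_op_def
proof (intro allI)
  fix x y
  have "bounded_linear (\<lambda>A :: 'a \<Rightarrow>\<^sub>L 'a. cinner (A x) y - cinner x (A y))"
    by (intro bounded_linear_sub
        bounded_linear_compose[OF bounded_bilinear.bounded_linear_left[OF bounded_bilinear_cinner]]
        bounded_linear_compose[OF bounded_bilinear.bounded_linear_right[OF bounded_bilinear_cinner]]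
        blinfun.bounded_linear_left)
  then have "cinner (D x) y - cinner x (D y) = 0"
    by (rule vector_derivative_in_kernel[OF _ _ assms(2)]) (simp add: hermitian_opD[OF assms(1)])
  then show "cinner (D x) y = cinner x (D y)" by simp
qed

text \<open>The resolvent identity \<open>G s - G t = - (G s (F s - F t) G t)\<close> gives continuity of the inverse \<open>G\<close>
  and then, after division by \<open>s - t\<close>, its derivative.\<close>

lemma C1_operator_inverse:
  fixes F G :: "real \<Rightarrow> 'a::real_normed_vector \<Rightarrow>\<^sub>L 'a"
  assumes C1: "F C1_differentiable_on UNIV"
    and FG: "\<And>t. F t o\<^sub>L G t = id_blinfun" and GF: "\<And>t. G t o\<^sub>L F t = id_blinfun"
    and bd: "\<And>t. norm (G t) \<le> K"
  shows "G C1_differentiable_on UNIV"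
proof -
  obtain F' where F': "\<And>t. (F has_vector_derivative F' t) (at t)" and cF': "continuous_on UNIV F'"
    using C1 by (auto simp: C1_differentiable_on_def)
  have FGx: "F t (G t x) = x" for t x using arg_cong[OF FG[of t], of "\<lambda>A. A x"] by simp
  have GFx: "G t (F t x) = x" for t x using arg_cong[OF GF[of t], of "\<lambda>A. A x"] by simp
  have resolvent: "G s - G t = - (G s o\<^sub>L (F s - F t) o\<^sub>L G t)" for s t
    by (rule blinfun_eqI)
      (simp add: blinfun.diff_left blinfun.minus_left blinfun.diff_right FGx GFx)
  have "0 \<le> K" using bd[of 0] norm_ge_zero by (rule order_trans[rotated])
  have contF: "(F \<longlongrightarrow> F t) (at t)" for t
    using has_vector_derivative_continuous[OF F'[of t]] by (simp add: isCont_def)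
  have contG: "(G \<longlongrightarrow> G t) (at t)" for t
  proof -
    have "norm (G s - G t) \<le> K * norm (F s - F t) * K" for s
    proof -
      have "norm (G s - G t) \<le> norm (G s o\<^sub>L (F s - F t)) * norm (G t)"
        unfolding resolvent norm_minus_cancel by (rule norm_blinfun_compose)
      also have "\<dots> \<le> (norm (G s) * norm (F s - F t)) * norm (G t)"
        by (intro mult_right_mono norm_blinfun_compose norm_ge_zero)
      also have "\<dots> \<le> (K * norm (F s - F t)) * K"
        by (intro mult_mono mult_right_mono bd) (simp_all add: \<open>0 \<le> K\<close>)
      finally show ?thesis .
    qed
    moreover have "((\<lambda>s. K * norm (F s - F t) * K) \<longlongrightarrow> K * 0 * K) (at t)"
      by (intro tendsto_intros tendsto_norm_zero LIM_zero contF)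
    ultimately have "((\<lambda>s. G s - G t) \<longlongrightarrow> 0) (at t)"
      unfolding mult_zero_right mult_zero_left
      by (rule Lim_null_comparison[OF always_eventually[OF allI]])
    then show ?thesis by (rule LIM_zero_cancel)
  qed
  note tendsto_o = bounded_bilinear.tendsto[OF bounded_bilinear_blinfun_compose]
  note cont_o = bounded_bilinear.continuous_on[OF bounded_bilinear_blinfun_compose]
  have "(G has_vector_derivative - (G t o\<^sub>L F' t o\<^sub>L G t)) (at t)" for t
    unfolding has_vector_derivative_iff_slope
  proof (rule Lim_transform_eventually)
    show "((\<lambda>s. - (G s o\<^sub>L ((F s - F t) /\<^sub>R (s - t)) o\<^sub>L G t)) \<longlongrightarrow> - (G t o\<^sub>L F' t o\<^sub>L G t)) (at t)"
      by (rule tendsto_minus[OF tendsto_o[OF tendsto_o[OF contG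
            F'[of t, unfolded has_vector_derivative_iff_slope]] tendsto_const]])
    have "- (G s o\<^sub>L ((F s - F t) /\<^sub>R (s - t)) o\<^sub>L G t) = (G s - G t) /\<^sub>R (s - t)" for s
      unfolding resolvent[of s t]
      by (rule blinfun_eqI) (simp add: blinfun.minus_left blinfun.scaleR_left blinfun.scaleR_right)
    then show "\<forall>\<^sub>F s in at t. - (G s o\<^sub>L ((F s - F t) /\<^sub>R (s - t)) o\<^sub>L G t) = (G s - G t) /\<^sub>R (s - t)"
      by simp
  qed
  moreover have "continuous_on UNIV G"
    using contG by (simp add: continuous_on_eq_continuous_at isCont_def)
  then have "continuous_on UNIV (\<lambda>t. - (G t o\<^sub>L F' t o\<^sub>L G t))"
    by (intro continuous_on_minus cont_o cF')
  ultimately show ?thesis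
    unfolding C1_differentiable_on_def by (intro exI[of _ "\<lambda>t. - (G t o\<^sub>L F' t o\<^sub>L G t)"] conjI ballI)
qed

text \<open>Differentiating \<open>S\<^sup>2 = P\<close> gives the Sylvester equation \<open>S D + D S = P'\<close> for the derivative
  \<open>D\<close> of \<open>S\<close>.  The increments and the difference quotients of \<open>S\<close> satisfy Sylvester equations too,
  so continuity, differentiability and continuity of \<open>D\<close> are all read off the Sylvester estimate.\<close>

theorem C1_sqrt_op:
  fixes P :: "real \<Rightarrow> 'a::fin_dim_complex_hilbert \<Rightarrow>\<^sub>L 'a"
  assumes C1: "P C1_differentiable_on UNIV"
    and herm: "\<And>t. hermitian_op (P t)" and coer: "\<And>t. coercive (P t) (m\<^sup>2)" and m: "0 < m"
  shows "(\<lambda>t. sqrt_op (P t)) C1_differentiable_on UNIV"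
proof -
  define S where "S t = sqrt_op (P t)" for t
  have hS: "hermitian_op (S t)" and cS: "coercive (S t) m" and SS: "S t o\<^sub>L S t = P t" for t
    using sqrt_op[OF herm coer m] by (simp_all add: S_def)
  have SSx: "S t (S t x) = P t x" for t x using arg_cong[OF SS[of t], of "\<lambda>A. A x"] by simp
  have est: "2 * m * norm Y \<le> norm ((S s o\<^sub>L Y) + (Y o\<^sub>L S t))" if "hermitian_op Y" for Y s t
    using sylvester_estimate[OF that cS[of s] cS[of t]] m by simp
  obtain P' where P': "\<And>t. (P has_vector_derivative P' t) (at t)" and cP': "continuous_on UNIV P'"
    using C1 by (auto simp: C1_differentiable_on_def)
  have "\<exists>D. hermitian_op D \<and> (S t o\<^sub>L D) + (D o\<^sub>L S t) = P' t" for t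
    using sylvester_solution[OF hS cS m hermitian_vector_derivative[OF herm P']] by metis
  then obtain D where hD: "\<And>t. hermitian_op (D t)" and D: "\<And>t. (S t o\<^sub>L D t) + (D t o\<^sub>L S t) = P' t"
    by metis
  have Dx: "S t (D t x) + D t (S t x) = P' t x" for t x
    using arg_cong[OF D[of t], of "\<lambda>A. A x"] by (simp add: blinfun.add_left)
  have lip: "2 * m * norm (S s - S t) \<le> norm (P s - P t)" for s t
  proof -
    have "(S s o\<^sub>L (S s - S t)) + ((S s - S t) o\<^sub>L S t) = P s - P t"
      by (rule blinfun_eqI) (simp add: blinfun.add_left blinfun.diff_left blinfun.diff_right SSx)
    then show ?thesis using est[OF hermitian_op_diff[OF hS[of s] hS[of t]], of s t] by simp
  qed
  have contP: "(P \<longlongrightarrow> P t) (at t)" for t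
    using has_vector_derivative_continuous[OF P'[of t]] by (simp add: isCont_def)
  have incS: "((\<lambda>s. S s - S t) \<longlongrightarrow> 0) (at t)" for t
  proof (rule Lim_null_comparison)
    have "norm (S s - S t) \<le> norm (P s - P t) / (2 * m)" for s
      using lip[of s t] m by (simp add: pos_le_divide_eq mult_ac)
    then show "\<forall>\<^sub>F s in at t. norm (S s - S t) \<le> norm (P s - P t) / (2 * m)" by simp
    have "((\<lambda>s. norm (P s - P t) / (2 * m)) \<longlongrightarrow> 0 / (2 * m)) (at t)"
      by (intro tendsto_divide tendsto_norm_zero LIM_zero contP tendsto_const) (use m in simp)
    then show "((\<lambda>s. norm (P s - P t) / (2 * m)) \<longlongrightarrow> 0) (at t)" by simp
  qed
  have deriv: "(S has_vector_derivative D t) (at t)" for t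
    unfolding has_vector_derivative_iff_slope
  proof (rule LIM_zero_cancel, rule Lim_null_comparison)
    define q where "q s = (P s - P t) /\<^sub>R (s - t)" for s
    define g where "g s = (norm (q s - P' t) + norm (S s - S t) * (norm (q s) / (2 * m))) / (2 * m)" for s
    have "norm ((S s - S t) /\<^sub>R (s - t) - D t) \<le> g s" if "s \<noteq> t" for s
    proof -
      define Y where "Y = (S s - S t) /\<^sub>R (s - t) - D t"
      have "hermitian_op Y" unfolding Y_def by (intro hermitian_op_diff hermitian_op_scaleR hS hD)
      have "(S t o\<^sub>L Y) + (Y o\<^sub>L S t) = (q s - P' t) - ((S s - S t) o\<^sub>L ((S s - S t) /\<^sub>R (s - t)))"
        by (rule blinfun_eqI)
          (simp add: Y_def q_def Dx[symmetric] blinfun.add_left blinfun.add_right blinfun.diff_left blinfun.diff_right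
            blinfun.scaleR_left blinfun.scaleR_right SSx scaleR_diff_right algebra_simps)
      then have "2 * m * norm Y \<le> norm ((q s - P' t) - ((S s - S t) o\<^sub>L ((S s - S t) /\<^sub>R (s - t))))"
        using est[OF \<open>hermitian_op Y\<close>, of t t] by simp
      also have "\<dots> \<le> norm (q s - P' t) + norm ((S s - S t) o\<^sub>L ((S s - S t) /\<^sub>R (s - t)))"
        by (rule norm_triangle_ineq4)
      also have "\<dots> \<le> norm (q s - P' t) + norm (S s - S t) * norm ((S s - S t) /\<^sub>R (s - t))"
        by (intro add_left_mono norm_blinfun_compose)
      also have "\<dots> \<le> norm (q s - P' t) + norm (S s - S t) * (norm (q s) / (2 * m))"
      proof (intro add_left_mono mult_left_mono norm_ge_zero)
        have "norm (S s - S t) \<le> norm (P s - P t) / (2 * m)"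
          using lip[of s t] m by (simp add: pos_le_divide_eq mult_ac)
        then have "inverse \<bar>s - t\<bar> * norm (S s - S t) \<le> inverse \<bar>s - t\<bar> * (norm (P s - P t) / (2 * m))"
          by (rule mult_left_mono) simp
        then show "norm ((S s - S t) /\<^sub>R (s - t)) \<le> norm (q s) / (2 * m)" by (simp add: q_def)
      qed
      finally have "norm Y \<le> g s" using m by (simp add: g_def pos_le_divide_eq mult_ac)
      then show ?thesis by (simp only: Y_def)
    qed
    then show "\<forall>\<^sub>F s in at t. norm ((S s - S t) /\<^sub>R (s - t) - D t) \<le> g s"
      by (auto simp: eventually_at_filter)
    have "(q \<longlongrightarrow> P' t) (at t)"
      using P'[of t] unfolding has_vector_derivative_iff_slope q_def .
    then have "(g \<longlongrightarrow> (0 + 0 * (norm (P' t) / (2 * m))) / (2 * m)) (at t)"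
      unfolding g_def
      by (intro tendsto_divide tendsto_add tendsto_mult tendsto_norm_zero LIM_zero tendsto_norm
          incS tendsto_const) (use m in auto)
    then show "(g \<longlongrightarrow> 0) (at t)" by simp
  qed
  have "(D \<longlongrightarrow> D t) (at t)" for t
  proof (rule LIM_zero_cancel, rule Lim_null_comparison)
    define g where "g s = (norm (P' s - P' t) + 2 * norm (S s - S t) * norm (D t)) / (2 * m)" for s
    have "norm (D s - D t) \<le> g s" for s
    proof -
      have "(S s o\<^sub>L (D s - D t)) + ((D s - D t) o\<^sub>L S s)
          = (P' s - P' t) - (((S s - S t) o\<^sub>L D t) + (D t o\<^sub>L (S s - S t)))"
        by (rule blinfun_eqI)
          (simp add: Dx[symmetric] blinfun.add_left blinfun.diff_left blinfun.diff_right algebra_simps)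
      then have "2 * m * norm (D s - D t)
          \<le> norm ((P' s - P' t) - (((S s - S t) o\<^sub>L D t) + (D t o\<^sub>L (S s - S t))))"
        using est[OF hermitian_op_diff[OF hD[of s] hD[of t]], of s s] by simp
      also have "\<dots> \<le> norm (P' s - P' t) + norm (((S s - S t) o\<^sub>L D t) + (D t o\<^sub>L (S s - S t)))"
        by (rule norm_triangle_ineq4)
      also have "\<dots> \<le> norm (P' s - P' t) + (norm (S s - S t) * norm (D t) + norm (D t) * norm (S s - S t))"
        by (intro add_left_mono norm_triangle_le add_mono norm_blinfun_compose)
      finally show ?thesis using m by (simp add: g_def pos_le_divide_eq mult_ac)
    qed
    then show "\<forall>\<^sub>F s in at t. norm (D s - D t) \<le> g s" by simp
    have "(P' \<longlongrightarrow> P' t) (at t)"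
      using cP' by (simp add: continuous_on_eq_continuous_at isCont_def)
    then have "(g \<longlongrightarrow> (0 + 2 * 0 * norm (D t)) / (2 * m)) (at t)"
      unfolding g_def
      by (intro tendsto_divide tendsto_add tendsto_mult tendsto_norm_zero LIM_zero
          incS tendsto_const) (use m in auto)
    then show "(g \<longlongrightarrow> 0) (at t)" by simp
  qed
  then have "continuous_on UNIV D" by (simp add: continuous_on_eq_continuous_at isCont_def)
  then have "S C1_differentiable_on UNIV" using deriv by (auto simp: C1_differentiable_on_def)
  then show ?thesis unfolding S_def[abs_def] .
qed

text \<open>The right-hand side is defined and real-linear in \<open>A\<close> for all bounded real-linear \<open>A\<close>, whereas the
  adjoint itself is meaningful for complex-linear \<open>A\<close> only.\<close>

lemma hadjoint_eq_sum:
  fixes A :: "'a::fin_dim_complex_hilbert \<Rightarrow>\<^sub>L 'b::complex_inner"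
  assumes "clinear_op A"
  shows "A\<^sup>\<dagger> = (\<Sum>i<length (onb :: 'a list). rank_one (onb ! i) (A (onb ! i)))"
proof (rule blinfun_eqI)
  fix y
  have "(A\<^sup>\<dagger>) y = (\<Sum>i<length (onb :: 'a list). cinner (onb ! i) ((A\<^sup>\<dagger>) y) *\<^sub>C onb ! i)"
    by (rule basis_expansion[OF orthonormal_basis_onb])
  then show "(A\<^sup>\<dagger>) y = (\<Sum>i<length (onb :: 'a list). rank_one (onb ! i) (A (onb ! i))) y"
    by (simp add: blinfun.sum_left rank_one_apply hadjoint[OF assms])
qed

lemma C1_hadjoint:
  fixes F :: "real \<Rightarrow> 'a::fin_dim_complex_hilbert \<Rightarrow>\<^sub>L 'b::complex_inner"
  assumes "F C1_differentiable_on S" "\<And>t. clinear_op (F t)"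
  shows "(\<lambda>t. (F t)\<^sup>\<dagger>) C1_differentiable_on S"
proof -
  have "bounded_linear (\<lambda>A :: 'a \<Rightarrow>\<^sub>L 'b. \<Sum>i<length (onb :: 'a list). rank_one (onb ! i) (A (onb ! i)))"
    by (intro bounded_linear_sum bounded_linear_compose[OF bounded_linear_rank_one]
        blinfun.bounded_linear_left)
  from C1_bounded_linear[OF this assms(1)] show ?thesis
    by (simp add: hadjoint_eq_sum[OF assms(2)])
qed

section \<open>The polar decomposition\<close>

definition bounded_below :: "('a::complex_inner \<Rightarrow>\<^sub>L 'b::complex_inner) \<Rightarrow> real \<Rightarrow> bool" where
  "bounded_below A m \<longleftrightarrow> (\<forall>x. m * norm x \<le> norm (A x))"

lemma hermitian_gram:
  fixes A :: "'a::fin_dim_complex_hilbert \<Rightarrow>\<^sub>L 'b::complex_inner"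
  assumes "clinear_op A"
  shows "hermitian_op (A\<^sup>\<dagger> o\<^sub>L A)"
  by (simp add: hermitian_op_def hadjoint[OF assms, symmetric] cinner_hadjoint_left[OF assms])

lemma coercive_gram:
  fixes A :: "'a::fin_dim_complex_hilbert \<Rightarrow>\<^sub>L 'b::complex_inner"
  assumes "clinear_op A" "bounded_below A m" "0 < m"
  shows "coercive (A\<^sup>\<dagger> o\<^sub>L A) (m\<^sup>2)"
  unfolding coercive_def
proof
  fix x
  have "(m * norm x)\<^sup>2 \<le> (norm (A x))\<^sup>2"
    using assms(2,3) by (intro power_mono) (auto simp: bounded_below_def)
  then show "m\<^sup>2 * (norm x)\<^sup>2 \<le> Re (cinner x ((A\<^sup>\<dagger> o\<^sub>L A) x))"
    by (simp add: hadjoint[OF assms(1), symmetric] Re_cinner_self power_mult_distrib)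
qed

definition polar_unitary_op :: "('a::complex_inner \<Rightarrow>\<^sub>L 'a) \<Rightarrow> 'a \<Rightarrow>\<^sub>L 'a" where
  "polar_unitary_op A = A o\<^sub>L inverse_op (sqrt_op (A\<^sup>\<dagger> o\<^sub>L A))"

lemma polar_unitary_eq: "polar_unitary M z t = polar_unitary_op (shifted M z t)"
  by (simp add: polar_unitary_def polar_unitary_op_def)

lemma coercive_imp_inverse:
  fixes S :: "'a::fin_dim_complex_hilbert \<Rightarrow>\<^sub>L 'a"
  assumes "hermitian_op S" "coercive S m" "0 < m"
  shows "S o\<^sub>L inverse_op S = id_blinfun" "inverse_op S o\<^sub>L S = id_blinfun"
    "hermitian_op (inverse_op S)" "norm (inverse_op S) \<le> 1 / m"
proof -
  have gap: "m \<le> \<bar>r\<bar>" if "S v = r *\<^sub>R v" "v \<noteq> 0" for v r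
    using coercive_eigenvalue_ge[OF assms(2) that] by simp
  show "S o\<^sub>L inverse_op S = id_blinfun" "inverse_op S o\<^sub>L S = id_blinfun"
    "hermitian_op (inverse_op S)" "norm (inverse_op S) \<le> 1 / m"
    by (rule hermitian_inverse[OF assms(1,3)], erule (1) gap)+
qed

text \<open>Any factorisation \<open>A = U T\<close> with \<open>U\<close> unitary and \<open>T\<close> positive has \<open>T\<^sup>2\<close> equal to the Gram operator of
  \<open>A\<close>, so uniqueness of the square root determines \<open>T\<close>, and with it \<open>U\<close> since \<open>T\<close> is invertible.\<close>

lemma polar_decomposition:
  fixes A :: "'a::fin_dim_complex_hilbert \<Rightarrow>\<^sub>L 'a"
  assumes lin: "clinear_op A" and bd: "bounded_below A m" and m: "0 < m" and inv: "invertible_op A"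
  defines "S \<equiv> sqrt_op (A\<^sup>\<dagger> o\<^sub>L A)"
  shows "hermitian_op S" "coercive S m" "unitary_op (polar_unitary_op A)"
    "A = polar_unitary_op A o\<^sub>L S" "A\<^sup>\<dagger> = S o\<^sub>L (polar_unitary_op A)\<^sup>\<dagger>"
    "unitary_polar_factor U A \<longleftrightarrow> U = polar_unitary_op A"
proof -
  note sq = sqrt_op[OF hermitian_gram[OF lin] coercive_gram[OF lin bd m] m, folded S_def]
  show hS: "hermitian_op S" and cS: "coercive S m" by (rule sq)+
  have SSx: "S (S x) = (A\<^sup>\<dagger>) (A x)" for x using arg_cong[OF sq(3), of "\<lambda>F. F x"] by simp
  define X where "X = inverse_op S"
  note X = coercive_imp_inverse[OF hS cS m, folded X_def]
  have SXx: "S (X x) = x" for x using arg_cong[OF X(1), of "\<lambda>F. F x"] by simp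
  have XSx: "X (S x) = x" for x using arg_cong[OF X(2), of "\<lambda>F. F x"] by simp
  define Q where "Q = polar_unitary_op A"
  have Q: "Q = A o\<^sub>L X" by (simp add: Q_def polar_unitary_op_def X_def S_def)
  have linQ: "clinear_op Q" unfolding Q by (intro clinear_op_compose lin hermitian_imp_clinear X(3))
  have adjQ: "Q\<^sup>\<dagger> = X o\<^sub>L A\<^sup>\<dagger>"
    unfolding Q by (simp add: hadjoint_compose[OF lin hermitian_imp_clinear[OF X(3)]] hermitian_op_adjoint[OF X(3)])
  have QQ: "Q\<^sup>\<dagger> o\<^sub>L Q = id_blinfun"
    by (rule blinfun_eqI) (simp add: adjQ, simp add: Q SSx[symmetric] SXx XSx)
  obtain B where AB: "A o\<^sub>L B = id_blinfun" using inv by (auto simp: invertible_op_def)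
  have ABx: "A (B x) = x" for x using arg_cong[OF AB, of "\<lambda>F. F x"] by simp
  have QQ': "Q o\<^sub>L Q\<^sup>\<dagger> = id_blinfun"
  proof (rule blinfun_eqI)
    fix x
    have "(Q o\<^sub>L Q\<^sup>\<dagger>) x = (Q o\<^sub>L Q\<^sup>\<dagger>) (A (B x))" by (simp only: ABx)
    also have "\<dots> = A (B x)" by (simp add: adjQ, simp add: Q SSx[symmetric] XSx)
    finally show "(Q o\<^sub>L Q\<^sup>\<dagger>) x = id_blinfun x" by (simp add: ABx)
  qed
  show unit: "unitary_op (polar_unitary_op A)"
    using linQ QQ QQ' by (simp add: unitary_op_def Q_def)
  show AQS: "A = polar_unitary_op A o\<^sub>L S"
    unfolding Q_def[symmetric] by (rule blinfun_eqI) (simp add: Q XSx)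
  show "A\<^sup>\<dagger> = S o\<^sub>L (polar_unitary_op A)\<^sup>\<dagger>"
    unfolding Q_def[symmetric] by (rule blinfun_eqI) (simp add: adjQ SXx)
  have pS: "positive_op S"
    using hS coercive_mono[OF cS, of 0] m by (simp add: positive_op_iff)
  show "unitary_polar_factor U A \<longleftrightarrow> U = polar_unitary_op A"
  proof
    assume "U = polar_unitary_op A"
    then show "unitary_polar_factor U A"
      using unit AQS pS unfolding unitary_polar_factor_def by blast
  next
    assume "unitary_polar_factor U A"
    then obtain T where U: "unitary_op U" and T: "positive_op T" and A: "A = U o\<^sub>L T"
      by (auto simp: unitary_polar_factor_def)
    have linU: "clinear_op U" and UU: "U\<^sup>\<dagger> o\<^sub>L U = id_blinfun" using U by (auto simp: unitary_op_def)
    have UUx: "(U\<^sup>\<dagger>) (U x) = x" for x using arg_cong[OF UU, of "\<lambda>F. F x"] by simp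
    have hT: "hermitian_op T" using T by (simp add: positive_op_iff)
    have "A\<^sup>\<dagger> = T o\<^sub>L U\<^sup>\<dagger>"
      unfolding A hadjoint_compose[OF linU hermitian_imp_clinear[OF hT]] hermitian_op_adjoint[OF hT] ..
    then have "T o\<^sub>L T = A\<^sup>\<dagger> o\<^sub>L A" by (intro blinfun_eqI) (simp add: A UUx)
    then have "T = S" by (rule sq(4)[OF T])
    have "U x = Q x" for x
      by (simp add: Q A \<open>T = S\<close> SXx)
    then show "U = polar_unitary_op A" unfolding Q_def[symmetric] by (rule blinfun_eqI)
  qed
qed

lemma C1_polar_unitary_op:
  fixes A :: "real \<Rightarrow> 'a::fin_dim_complex_hilbert \<Rightarrow>\<^sub>L 'a"
  assumes C1: "A C1_differentiable_on UNIV"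
    and lin: "\<And>t. clinear_op (A t)" and bd: "\<And>t. bounded_below (A t) m" and m: "0 < m"
  shows "(\<lambda>t. polar_unitary_op (A t)) C1_differentiable_on UNIV"
proof -
  let ?S = "\<lambda>t. sqrt_op ((A t)\<^sup>\<dagger> o\<^sub>L A t)"
  have "(\<lambda>t. (A t)\<^sup>\<dagger> o\<^sub>L A t) C1_differentiable_on UNIV"
    by (intro C1_bounded_bilinear[OF bounded_bilinear_blinfun_compose] C1_hadjoint C1 lin)
  then have C1S: "?S C1_differentiable_on UNIV"
    by (rule C1_sqrt_op[where m = m]) (intro hermitian_gram coercive_gram lin bd m)+
  note sq = sqrt_op[OF hermitian_gram[OF lin] coercive_gram[OF lin bd m] m]
  note inv = coercive_imp_inverse[OF sq(1,2) m]
  have "(\<lambda>t. inverse_op (?S t)) C1_differentiable_on UNIV"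
    by (rule C1_operator_inverse[OF C1S]) (rule inv)+
  then show ?thesis
    unfolding polar_unitary_op_def
    by (intro C1_bounded_bilinear[OF bounded_bilinear_blinfun_compose] C1)
qed

text \<open>The minimum of \<open>norm (A t x)\<close> over the compact set of all \<open>t\<close> and all unit vectors \<open>x\<close> is
  attained, and it is positive because every \<open>A t\<close> is injective.\<close>

lemma uniformly_bounded_below:
  fixes A :: "real \<Rightarrow> 'a::fin_dim_complex_hilbert \<Rightarrow>\<^sub>L 'b::complex_inner"
  assumes cont: "continuous_on {a..b} A"
    and inj: "\<And>t x. t \<in> {a..b} \<Longrightarrow> A t x = 0 \<Longrightarrow> x = 0"
  obtains m where "0 < m" "\<And>t. t \<in> {a..b} \<Longrightarrow> bounded_below (A t) m"
proof -
  let ?K = "{a..b} \<times> sphere (0 :: 'a) 1"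
  have cpt: "compact ?K" by (intro compact_Times compact_Icc compact_unit_sphere)
  have contK: "continuous_on ?K (\<lambda>p. norm (A (fst p) (snd p)))"
    by (intro continuous_intros bounded_bilinear.continuous_on[OF bounded_bilinear_blinfun_apply]
        continuous_on_compose2[OF cont]) auto
  obtain m where m: "0 < m" and le: "\<And>t x. t \<in> {a..b} \<Longrightarrow> norm x = 1 \<Longrightarrow> m \<le> norm (A t x)"
  proof (cases "?K = {}")
    case True
    then show ?thesis by (intro that[of 1]) auto
  next
    case False
    from continuous_attains_inf[OF cpt this contK]
    obtain p where p: "p \<in> ?K" and min: "\<And>q. q \<in> ?K \<Longrightarrow> norm (A (fst p) (snd p)) \<le> norm (A (fst q) (snd q))"
      by blast
    have "A (fst p) (snd p) \<noteq> 0" using p inj[of "fst p" "snd p"] by auto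
    then show ?thesis using min by (intro that[of "norm (A (fst p) (snd p))"]) force+
  qed
  have "m * norm x \<le> norm (A t x)" if t: "t \<in> {a..b}" for t x
  proof (cases "x = 0")
    case False
    then have "m \<le> norm (A t ((1 / norm x) *\<^sub>R x))" by (intro le t) simp
    then show ?thesis using False by (simp add: blinfun.scaleR_right pos_le_divide_eq)
  qed simp
  then show thesis using m that by (auto simp: bounded_below_def)
qed

section \<open>Trace, determinant and Jacobi's formula\<close>

lemma trace_op_eq_sum: "trace_op (A :: 'a::fin_dim_complex_hilbert \<Rightarrow>\<^sub>L 'a)
    = (\<Sum>i<length (onb :: 'a list). cinner (onb ! i) (A (onb ! i)))"
  by (simp add: trace_op_def matrix_op_def)

lemma bounded_linear_trace_op: "bounded_linear (trace_op :: ('a::fin_dim_complex_hilbert \<Rightarrow>\<^sub>L 'a) \<Rightarrow> complex)"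
  unfolding trace_op_eq_sum
  by (intro bounded_linear_sum
      bounded_linear_compose[OF bounded_bilinear.bounded_linear_right[OF bounded_bilinear_cinner]]
      blinfun.bounded_linear_left)

lemma matrix_op_carrier: "matrix_op bs A \<in> carrier_mat (length bs) (length bs)"
  by (simp add: matrix_op_def)

lemma det_op_compose:
  fixes A B :: "'a::fin_dim_complex_hilbert \<Rightarrow>\<^sub>L 'a"
  assumes "clinear_op A"
  shows "det_op (A o\<^sub>L B) = det_op A * det_op B"
proof -
  let ?e = "onb :: 'a list"
  have "matrix_op ?e (A o\<^sub>L B) = matrix_op ?e A * matrix_op ?e B"
    by (rule eq_matI)
      (simp_all add: matrix_op_def scalar_prod_def lessThan_atLeast0
        cinner_apply_expansion[OF orthonormal_basis_onb assms, of _ "B _"])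
  then show ?thesis
    unfolding det_op_def by (simp add: Determinant.det_mult[OF matrix_op_carrier matrix_op_carrier])
qed

lemma det_op_id: "det_op (id_blinfun :: 'a::fin_dim_complex_hilbert \<Rightarrow>\<^sub>L 'a) = 1"
proof -
  have "matrix_op (onb :: 'a list) id_blinfun = 1\<^sub>m (length (onb :: 'a list))"
    by (rule eq_matI) (simp_all add: matrix_op_def cinner_basis[OF orthonormal_basis_onb])
  then show ?thesis by (simp add: det_op_def)
qed

lemma det_op_eigenbasis:
  fixes A :: "'a::fin_dim_complex_hilbert \<Rightarrow>\<^sub>L 'a"
  assumes "clinear_op A" "eigenbasis A bs l"
  shows "det_op A = complex_of_real (\<Prod>i<length bs. l i)"
proof -
  have on: "orthonormal_basis bs" using assms(2) by (simp add: eigenbasis_def)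
  have entry: "matrix_op bs A $$ (i, j) = (if i = j then complex_of_real (l i) else 0)"
    if "i < length bs" "j < length bs" for i j
    using assms(2) that cinner_basis[OF on that]
    by (simp add: matrix_op_def eigenbasis_def cinner_scaleR_right scaleR_conv_of_real)
  have "upper_triangular (matrix_op bs A)"
    by (auto simp: upper_triangular_def entry matrix_op_def[of bs A, THEN arg_cong, of dim_row])
  then have "det_op A = (\<Prod>i = 0..<length bs. matrix_op bs A $$ (i, i))"
    unfolding det_op_eq[OF on assms(1)]
    by (subst det_upper_triangular[OF _ matrix_op_carrier])
      (simp_all add: prod_list_diag_prod matrix_op_def)
  then show ?thesis by (simp add: entry lessThan_atLeast0)
qed

lemma det_op_expand:
  fixes A :: "'a::fin_dim_complex_hilbert \<Rightarrow>\<^sub>L 'a"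
  defines "n \<equiv> length (onb :: 'a list)"
  shows "det_op A = (\<Sum>p | p permutes {0..<n}.
    signof p * (\<Prod>i = 0..<n. cinner (onb ! i) (A (onb ! p i))))"
proof -
  have "det_op A = (\<Sum>p | p permutes {0..<n}.
      signof p * (\<Prod>i = 0..<n. matrix_op (onb :: 'a list) A $$ (i, p i)))"
    unfolding det_op_def n_def by (rule det_def'[OF matrix_op_carrier])
  also have "\<dots> = (\<Sum>p | p permutes {0..<n}.
      signof p * (\<Prod>i = 0..<n. cinner (onb ! i) (A (onb ! p i))))"
  proof (intro sum.cong refl arg_cong2[of _ _ _ _ "(*)"] prod.cong)
    fix p i assume "p \<in> {p. p permutes {0..<n}}" "i \<in> {0..<n}"
    then have "i < n" "p i < n" using permutes_in_image[of p "{0..<n}" i] by auto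
    then show "matrix_op (onb :: 'a list) A $$ (i, p i) = cinner (onb ! i) (A (onb ! p i))"
      by (simp add: matrix_op_def n_def)
  qed
  finally show ?thesis .
qed

lemma continuous_on_det_op:
  fixes F :: "'b::topological_space \<Rightarrow> 'a::fin_dim_complex_hilbert \<Rightarrow>\<^sub>L 'a"
  assumes "continuous_on S F"
  shows "continuous_on S (\<lambda>s. det_op (F s))"
  unfolding det_op_expand
  by (intro continuous_on_sum continuous_on_mult continuous_on_prod continuous_on_cinner
      blinfun.continuous_on assms continuous_on_const)

lemma permutes_fixing_all_but_one:
  assumes "p permutes I" "\<And>j. j \<in> I - {i} \<Longrightarrow> p j = j"
  shows "p = id"
proof
  fix k
  show "p k = id k"
  proof (cases "k \<in> I")
    case True
    have "p i = i" if "i \<in> I"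
    proof (rule ccontr)
      assume "p i \<noteq> i"
      then have "p (p i) = p i" using assms permutes_in_image[of p I i] that by auto
      then show False using \<open>p i \<noteq> i\<close> permutes_inj[OF assms(1)] by (auto dest: injD)
    qed
    then show ?thesis using True assms(2)[of k] by (cases "k = i") auto
  qed (use assms(1) in \<open>simp add: permutes_not_in\<close>)
qed

text \<open>In the Leibniz expansion each summand is a product of entries, whose derivative keeps all but
  one factor.  At the identity those remaining factors vanish unless the permutation fixes all but one
  index, hence every index; so only the derivatives of the diagonal entries survive.\<close>

lemma det_op_derivative_at_id:
  fixes B :: "real \<Rightarrow> 'a::fin_dim_complex_hilbert \<Rightarrow>\<^sub>L 'a"
  assumes "(B has_vector_derivative D) (at t)" and "B t = id_blinfun"
  shows "((\<lambda>s. det_op (B s)) has_vector_derivative trace_op D) (at t)"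
proof -
  define n where "n = length (onb :: 'a list)"
  define I where "I = {0..<n}"
  define b where "b i j s = cinner (onb ! i) (B s (onb ! j))" for i j s
  define d where "d i j = cinner (onb ! i) (D (onb ! j))" for i j
  have bd: "(b i j has_vector_derivative d i j) (at t)" for i j
    unfolding b_def[abs_def] d_def
    by (rule bounded_linear.has_vector_derivative[OF _ assms(1)])
      (intro bounded_linear_compose[OF bounded_bilinear.bounded_linear_right[OF bounded_bilinear_cinner]]
        blinfun.bounded_linear_left)
  have bt: "b i j t = (if i = j then 1 else 0)" if "i \<in> I" "j \<in> I" for i j
    using that by (simp add: b_def assms(2) I_def n_def cinner_basis[OF orthonormal_basis_onb])
  have "((\<lambda>s. \<Prod>i\<in>I. b i (p i) s) has_vector_derivative
      (\<Sum>i\<in>I. d i (p i) * (\<Prod>j\<in>I - {i}. b j (p j) t))) (at t)" for p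
    unfolding has_vector_derivative_def
    by (rule has_derivative_eq_rhs[OF has_derivative_prod[OF bd[unfolded has_vector_derivative_def]]])
      (simp add: scaleR_sum_right)
  then have "((\<lambda>s. \<Sum>p | p permutes I. signof p * (\<Prod>i\<in>I. b i (p i) s)) has_vector_derivative
      (\<Sum>p | p permutes I. signof p * (\<Sum>i\<in>I. d i (p i) * (\<Prod>j\<in>I - {i}. b j (p j) t)))) (at t)"
    by (intro has_vector_derivative_sum has_vector_derivative_mult_right)
  moreover have "(\<Sum>p | p permutes I. signof p * (\<Sum>i\<in>I. d i (p i) * (\<Prod>j\<in>I - {i}. b j (p j) t)))
      = (\<Sum>p\<in>{id}. signof p * (\<Sum>i\<in>I. d i (p i) * (\<Prod>j\<in>I - {i}. b j (p j) t)))"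
  proof (rule sum.mono_neutral_right)
    show "finite {p. p permutes I}" by (rule finite_permutations) (simp add: I_def)
    show "{id} \<subseteq> {p. p permutes I}" by (simp add: permutes_id)
    show "\<forall>p\<in>{p. p permutes I} - {id}.
        signof p * (\<Sum>i\<in>I. d i (p i) * (\<Prod>j\<in>I - {i}. b j (p j) t)) = (0 :: complex)"
    proof
      fix p assume p: "p \<in> {p. p permutes I} - {id}"
      have "(\<Prod>j\<in>I - {i}. b j (p j) t) = 0" if "i \<in> I" for i
      proof -
        obtain j where j: "j \<in> I - {i}" "p j \<noteq> j"
          using p permutes_fixing_all_but_one[of p I i] by blast
        then have "b j (p j) t = 0" using p bt permutes_in_image[of p I j] by auto
        then show ?thesis using j by (intro prod_zero) (auto simp: I_def)
      qed
      then show "signof p * (\<Sum>i\<in>I. d i (p i) * (\<Prod>j\<in>I - {i}. b j (p j) t)) = (0 :: complex)"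
        by (simp add: sum.neutral)
    qed
  qed
  moreover have "\<dots> = (\<Sum>i\<in>I. d i i)" by (simp add: bt)
  moreover have "(\<Sum>i\<in>I. d i i) = trace_op D"
    by (simp add: trace_op_eq_sum d_def I_def n_def lessThan_atLeast0)
  moreover have "det_op (B s) = (\<Sum>p | p permutes I. signof p * (\<Prod>i\<in>I. b i (p i) s))" for s
    by (simp add: det_op_expand I_def n_def b_def)
  ultimately show ?thesis by simp
qed

lemma det_op_unitary_nonzero:
  fixes U :: "'a::fin_dim_complex_hilbert \<Rightarrow>\<^sub>L 'a"
  shows "unitary_op U \<Longrightarrow> det_op U \<noteq> 0"
  using det_op_compose[of U "U\<^sup>\<dagger>"] det_op_id[where 'a = 'a] by (auto simp: unitary_op_def)

text \<open>Splitting off the constant factor \<open>Q t\<close> leaves a family that is the identity at \<open>t\<close>.\<close>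

lemma det_op_unitary_derivative:
  fixes Q :: "real \<Rightarrow> 'a::fin_dim_complex_hilbert \<Rightarrow>\<^sub>L 'a"
  assumes Q': "(Q has_vector_derivative Q') (at t)" and U: "unitary_op (Q t)"
  shows "((\<lambda>s. det_op (Q s)) has_vector_derivative
    det_op (Q t) * trace_op ((Q t)\<^sup>\<dagger> o\<^sub>L Q')) (at t)"
proof -
  have lin: "clinear_op (Q t)" and QQ: "(Q t)\<^sup>\<dagger> o\<^sub>L Q t = id_blinfun" and QQ': "Q t o\<^sub>L (Q t)\<^sup>\<dagger> = id_blinfun"
    using U by (auto simp: unitary_op_def)
  have "((\<lambda>s. (Q t)\<^sup>\<dagger> o\<^sub>L Q s) has_vector_derivative ((Q t)\<^sup>\<dagger> o\<^sub>L Q')) (at t)"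
    by (rule bounded_linear.has_vector_derivative[OF
          bounded_bilinear.bounded_linear_right[OF bounded_bilinear_blinfun_compose] Q'])
  from has_vector_derivative_mult_right[OF det_op_derivative_at_id[OF this QQ], of "det_op (Q t)"]
  show ?thesis
  proof (rule back_subst[where P = "\<lambda>f. (f has_vector_derivative _) _"], intro ext)
    fix s
    have "Q s = Q t o\<^sub>L ((Q t)\<^sup>\<dagger> o\<^sub>L Q s)"
      using arg_cong[OF QQ', of "\<lambda>F. F (Q s _)"] by (intro blinfun_eqI) simp
    then show "det_op (Q t) * det_op ((Q t)\<^sup>\<dagger> o\<^sub>L Q s) = det_op (Q s)"
      using det_op_compose[OF lin, of "(Q t)\<^sup>\<dagger> o\<^sub>L Q s"] by simp
  qed
qed

section \<open>Winding numbers\<close>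

text \<open>The straight-line homotopy between the two loops never meets \<open>0\<close>.\<close>

lemma winding_number_positive_multiple:
  fixes p q :: "real \<Rightarrow> complex"
  assumes p: "path p" "pathfinish p = pathstart p" and q: "path q" "pathfinish q = pathstart q"
    and r: "\<And>s. s \<in> {0..1} \<Longrightarrow> \<exists>r>0. p s = complex_of_real r * q s"
    and q0: "\<And>s. s \<in> {0..1} \<Longrightarrow> q s \<noteq> 0"
  shows "winding_number p 0 = winding_number q 0"
proof (rule winding_number_homotopic_loops, rule homotopic_loops_linear)
  fix s :: real assume s: "s \<in> {0..1}"
  obtain r where r: "0 < r" "p s = complex_of_real r * q s" using r[OF s] by blast
  show "closed_segment (p s) (q s) \<subseteq> - {0}"
  proof
    fix x assume "x \<in> closed_segment (p s) (q s)"
    then obtain u where u: "0 \<le> u" "u \<le> 1" "x = (1 - u) *\<^sub>R p s + u *\<^sub>R q s"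
      by (auto simp: closed_segment_def)
    have "x = complex_of_real ((1 - u) * r + u) * q s"
      by (simp add: u(3) r(2) scaleR_conv_of_real algebra_simps)
    moreover have "0 < (1 - u) * r + u"
      using u(1,2) r(1) by (cases "u = 0") (auto intro: add_nonneg_pos)
    ultimately show "x \<in> - {0}" using q0[OF s] by (auto simp del: of_real_add of_real_mult)
  qed
qed (use p q in auto)

lemma winding_number_det_unitary_loop:
  fixes Q :: "real \<Rightarrow> 'a::fin_dim_complex_hilbert \<Rightarrow>\<^sub>L 'a"
  assumes Q': "\<And>t. (Q has_vector_derivative Q' t) (at t)" and cont: "continuous_on UNIV Q'"
    and U: "\<And>t. unitary_op (Q t)"
  defines "q \<equiv> \<lambda>s. det_op (Q (2 * pi * s))"
  shows "path q"
    and "winding_number q 0 = 1 / (2 * pi * \<i>) * integral {0..2*pi} (\<lambda>t. trace_op ((Q t)\<^sup>\<dagger> o\<^sub>L Q' t))"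
proof -
  define \<tau> where "\<tau> t = trace_op ((Q t)\<^sup>\<dagger> o\<^sub>L Q' t)" for t
  define q' where "q' s = (2 * pi) *\<^sub>R (q s * \<tau> (2 * pi * s))" for s
  have C1: "Q C1_differentiable_on UNIV" using Q' cont by (auto simp: C1_differentiable_on_def)
  have lin: "clinear_op (Q t)" for t using U by (auto simp: unitary_op_def)
  have contQ: "continuous_on UNIV Q" using C1 by (rule C1_differentiable_imp_continuous_on)
  have "continuous_on UNIV (\<lambda>t. (Q t)\<^sup>\<dagger>)"
    using C1_hadjoint[OF C1 lin] by (rule C1_differentiable_imp_continuous_on)
  then have cont\<tau>: "continuous_on UNIV \<tau>"
    unfolding \<tau>_def[abs_def]
    by (intro bounded_linear.continuous_on[OF bounded_linear_trace_op]
        bounded_bilinear.continuous_on[OF bounded_bilinear_blinfun_compose] cont)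
  have qd: "(q has_vector_derivative q' s) (at s)" for s
  proof -
    have "((\<lambda>s. 2 * pi * s) has_vector_derivative 2 * pi) (at s)"
      by (auto intro!: derivative_eq_intros simp: has_real_derivative_iff_has_vector_derivative[symmetric])
    from vector_diff_chain_at[OF this det_op_unitary_derivative[OF Q' U]]
    show ?thesis by (simp add: q_def q'_def \<tau>_def o_def)
  qed
  have contq: "continuous_on UNIV q"
    using qd by (intro continuous_at_imp_continuous_on ballI has_vector_derivative_continuous) auto
  have "continuous_on UNIV q'"
    unfolding q'_def[abs_def]
    by (intro continuous_intros contq continuous_on_compose2[OF cont\<tau>]) auto
  then have "q C1_differentiable_on UNIV" using qd by (auto simp: C1_differentiable_on_def)
  then have "q C1_differentiable_on {0..1}" by (rule C1_differentiable_on_subset) simp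
  then have vp: "valid_path q"
    unfolding valid_path_def by (rule C1_differentiable_imp_piecewise)
  then show "path q" by (rule valid_path_imp_path)
  have q0: "q s \<noteq> 0" for s unfolding q_def by (rule det_op_unitary_nonzero[OF U])
  then have "0 \<notin> path_image q" by (auto simp: path_image_def)
  from winding_number_valid_path[OF vp this]
  have "winding_number q 0 = 1 / (2 * pi * \<i>) * contour_integral q (\<lambda>w. 1 / (w - 0))" .
  also have "contour_integral q (\<lambda>w. 1 / (w - 0)) = integral {0..1} (\<lambda>s. (2 * pi) *\<^sub>R \<tau> (2 * pi * s))"
    unfolding contour_integral_integral
    by (intro integral_cong) (simp add: vector_derivative_at[OF qd] q'_def q0)
  also have "\<dots> = (2 * pi) *\<^sub>R integral {0..1} (\<lambda>s. \<tau> (2 * pi * s))" by (rule integral_cmul)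
  also have "{0..1} = (\<lambda>x. x / (2 * pi)) ` {0..2 * pi}"
    by (simp add: image_divide_atLeastAtMost)
  also have "integral ((\<lambda>x. x / (2 * pi)) ` {0..2 * pi}) (\<lambda>s. \<tau> (2 * pi * s))
      = (1 / \<bar>2 * pi\<bar>) *\<^sub>R integral {0..2 * pi} \<tau>"
    by (rule integral_stretch_real) simp
  finally show "winding_number q 0 = 1 / (2 * pi * \<i>) * integral {0..2*pi} (\<lambda>t. trace_op ((Q t)\<^sup>\<dagger> o\<^sub>L Q' t))"
    by (simp add: \<tau>_def[abs_def])
qed

section \<open>The Hermitized operator and its negative spectral subspace\<close>

lemma hermitian_hermitization:
  fixes M :: "real \<Rightarrow> 'e::fin_dim_complex_hilbert \<Rightarrow>\<^sub>L 'e"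
  assumes "clinear_op (shifted M z t)"
  shows "hermitian_op (hermitization M z t)"
  unfolding hermitian_op_def
proof (intro allI)
  fix p q :: "'e \<times> 'e"
  show "cinner (hermitization M z t p) q = cinner p (hermitization M z t q)"
    by (cases p; cases q)
      (simp add: cinner_prod_def hadjoint[OF assms] cinner_hadjoint_left[OF assms] add.commute)
qed

text \<open>With \<open>x = A y\<close> one has \<open>norm x ^ 2 = Re (cinner y (A\<^sup>\<dagger> x))\<close>, and \<open>m * norm y\<close> is at most \<open>norm x\<close>.\<close>

lemma bounded_below_hadjoint:
  fixes A :: "'a::fin_dim_complex_hilbert \<Rightarrow>\<^sub>L 'a"
  assumes lin: "clinear_op A" and bd: "bounded_below A m" and m: "0 < m" and inv: "invertible_op A"
  shows "bounded_below (A\<^sup>\<dagger>) m"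
  unfolding bounded_below_def
proof
  fix x
  obtain B where AB: "A o\<^sub>L B = id_blinfun" using inv by (auto simp: invertible_op_def)
  define y where "y = B x"
  have Ay: "A y = x" using arg_cong[OF AB, of "\<lambda>F. F x"] by (simp add: y_def)
  have "(norm x)\<^sup>2 = Re (cinner y ((A\<^sup>\<dagger>) x))"
    by (simp add: hadjoint[OF lin, symmetric] Ay Re_cinner_self)
  also have "\<dots> \<le> norm y * norm ((A\<^sup>\<dagger>) x)"
    using complex_Re_le_cmod cmod_cinner_le by (rule order_trans)
  finally have "m * (norm x)\<^sup>2 \<le> m * (norm y * norm ((A\<^sup>\<dagger>) x))"
    using m by simp
  also have "\<dots> \<le> norm x * norm ((A\<^sup>\<dagger>) x)"
    using bd mult_right_mono[of "m * norm y" "norm x" "norm ((A\<^sup>\<dagger>) x)"]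
    by (simp add: bounded_below_def Ay[symmetric] mult.assoc)
  finally have "norm x * (m * norm x) \<le> norm x * norm ((A\<^sup>\<dagger>) x)"
    by (simp only: power2_eq_square mult_ac)
  then show "m * norm x \<le> norm ((A\<^sup>\<dagger>) x)"
    by (cases "x = 0") simp_all
qed

lemma bounded_below_hermitization:
  fixes M :: "real \<Rightarrow> 'e::fin_dim_complex_hilbert \<Rightarrow>\<^sub>L 'e"
  assumes "bounded_below (shifted M z t) m" "bounded_below ((shifted M z t)\<^sup>\<dagger>) m" "0 < m"
  shows "bounded_below (hermitization M z t) m"
  unfolding bounded_below_def
proof
  fix p :: "'e \<times> 'e"
  obtain x y where p: "p = (x, y)" by (cases p)
  have "(m * norm y)\<^sup>2 \<le> (norm (shifted M z t y))\<^sup>2" "(m * norm x)\<^sup>2 \<le> (norm (((shifted M z t)\<^sup>\<dagger>) x))\<^sup>2"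
    using assms by (auto simp: bounded_below_def intro!: power_mono)
  then have "(m * norm p)\<^sup>2 \<le> (norm (hermitization M z t p))\<^sup>2"
    by (simp add: p norm_Pair power_mult_distrib distrib_left)
  then show "m * norm p \<le> norm (hermitization M z t p)"
    by (rule power2_le_imp_le) simp
qed

text \<open>The Hermitized operator is bounded below by \<open>m\<close> as well.  Shifting it by a real number \<open>r\<close> with
  \<open>\<bar>r\<bar> < m\<close> therefore leaves no eigenvalue of modulus below \<open>m - \<bar>r\<bar>\<close>, and a Hermitian operator
  without small eigenvalues is invertible.\<close>

lemma hermitization_spectral_gap:
  fixes M :: "real \<Rightarrow> 'e::fin_dim_complex_hilbert \<Rightarrow>\<^sub>L 'e"
  assumes lin: "clinear_op (shifted M z t)" and bd: "bounded_below (shifted M z t) m"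
    and m: "0 < m" and inv: "invertible_op (shifted M z t)"
  shows "cspectrum (hermitization M z t) \<inter> complex_of_real ` {-m<..<m} = {}"
proof -
  let ?H = "hermitization M z t"
  have bH: "bounded_below ?H m"
    by (rule bounded_below_hermitization[OF bd bounded_below_hadjoint[OF lin bd m inv] m])
  have "invertible_op (?H - scalar_op (complex_of_real r))" if r: "r \<in> {-m<..<m}" for r
  proof -
    have "hermitian_op (scalar_op (complex_of_real r) :: ('e \<times> 'e) \<Rightarrow>\<^sub>L ('e \<times> 'e))"
      by (simp add: hermitian_op_def cinner_scaleC_left cinner_scaleC_right)
    then have herm: "hermitian_op (?H - scalar_op (complex_of_real r))"
      by (intro hermitian_op_diff hermitian_hermitization lin)
    have "m - \<bar>r\<bar> \<le> \<bar>s\<bar>" if v: "(?H - scalar_op (complex_of_real r)) v = s *\<^sub>R v" "v \<noteq> 0" for v s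
    proof -
      have "?H v = (s + r) *\<^sub>R v"
        using v(1) by (simp add: blinfun.diff_left scaleR_eq_scaleC[symmetric] scaleR_left_distrib diff_eq_eq)
      then have "m * norm v \<le> \<bar>s + r\<bar> * norm v" using bH by (metis bounded_below_def norm_scaleR)
      then have "m \<le> \<bar>s + r\<bar>" using v(2) by simp
      then show ?thesis by linarith
    qed
    moreover have "0 < m - \<bar>r\<bar>" using r by auto
    ultimately show ?thesis using hermitian_inverse(5)[OF herm] by blast
  qed
  then show ?thesis by (auto simp: cspectrum_def)
qed

lemma clinear_negative_frame:
  assumes "clinear_op (polar_unitary M z t)"
  shows "clinear_op (negative_frame M z t)"
proof (rule clinear_opI)
  fix c x
  show "negative_frame M z t (c *\<^sub>C x) = c *\<^sub>C negative_frame M z t x"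
    by (simp add: clinear_op_scaleC[OF assms] scaleC_prod_def
        bounded_bilinear.scaleR_right[OF bounded_bilinear_scaleC])
qed

lemma negative_frame_adjoint_apply:
  fixes M :: "real \<Rightarrow> 'e::fin_dim_complex_hilbert \<Rightarrow>\<^sub>L 'e"
  assumes "clinear_op (polar_unitary M z t)"
  shows "((negative_frame M z t)\<^sup>\<dagger>) (u, v) = (1 / sqrt 2) *\<^sub>R (v - ((polar_unitary M z t)\<^sup>\<dagger>) u)"
proof (rule cinner_extensional)
  fix x
  have "cinner x (((negative_frame M z t)\<^sup>\<dagger>) (u, v)) = cinner (negative_frame M z t x) (u, v)"
    by (rule hadjoint[OF clinear_negative_frame[OF assms], symmetric])
  also have "\<dots> = cinner x ((1 / sqrt 2) *\<^sub>R (v - ((polar_unitary M z t)\<^sup>\<dagger>) u))"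
    by (simp add: cinner_prod_def cinner_scaleR_left cinner_scaleR_right cinner_minus_left
        cinner_diff_right hadjoint[OF assms, symmetric] scaleR_diff_right)
  finally show "cinner x (((negative_frame M z t)\<^sup>\<dagger>) (u, v))
      = cinner x ((1 / sqrt 2) *\<^sub>R (v - ((polar_unitary M z t)\<^sup>\<dagger>) u))" .
qed

lemma negative_frame_isometry:
  fixes M :: "real \<Rightarrow> 'e::fin_dim_complex_hilbert \<Rightarrow>\<^sub>L 'e"
  assumes "unitary_op (polar_unitary M z t)"
  shows "(negative_frame M z t)\<^sup>\<dagger> o\<^sub>L negative_frame M z t = id_blinfun"
proof (rule blinfun_eqI)
  fix x
  have lin: "clinear_op (polar_unitary M z t)"
    and "(polar_unitary M z t)\<^sup>\<dagger> o\<^sub>L polar_unitary M z t = id_blinfun"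
    using assms by (auto simp: unitary_op_def)
  from arg_cong[OF this(2), of "\<lambda>F. F x"]
  have "((polar_unitary M z t)\<^sup>\<dagger>) (polar_unitary M z t x) = x" by simp
  then show "((negative_frame M z t)\<^sup>\<dagger> o\<^sub>L negative_frame M z t) x = id_blinfun x"
    by (simp add: negative_frame_adjoint_apply[OF lin] blinfun.scaleR_right blinfun.minus_right
        scaleR_2[symmetric] flip: scaleR_add_right)
qed

text \<open>On the range of the frame the Hermitized operator acts as \<open>- S\<close>, where \<open>A = Q S\<close> is the polar
  decomposition.  Conversely, if \<open>(a, b)\<close> is an eigenvector for \<open>r < 0\<close>, let \<open>c\<close>
  be the image of \<open>a\<close> under the adjoint of \<open>Q\<close>.  The eigenvalue equation reads \<open>S b = r c\<close>, \<open>S c = r b\<close>, so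
  \<open>b + c\<close> would be an eigenvector of the positive definite \<open>S\<close> for \<open>r\<close>.  Hence it vanishes, and \<open>a = - Q b\<close>.\<close>

lemma range_negative_frame:
  fixes M :: "real \<Rightarrow> 'e::fin_dim_complex_hilbert \<Rightarrow>\<^sub>L 'e"
  assumes lin: "clinear_op (shifted M z t)" and bd: "bounded_below (shifted M z t) m"
    and m: "0 < m" and inv: "invertible_op (shifted M z t)"
  shows "range (blinfun_apply (negative_frame M z t))
    = negative_spectral_subspace (hermitization M z t)"
proof -
  let ?H = "hermitization M z t" and ?F = "negative_frame M z t"
  define A where "A = shifted M z t"
  define Q where "Q = polar_unitary M z t"
  define S where "S = sqrt_op (A\<^sup>\<dagger> o\<^sub>L A)"
  note pd = polar_decomposition[OF lin bd m inv, folded polar_unitary_eq A_def, folded Q_def S_def]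
  have linQ: "clinear_op Q" and QQ: "Q\<^sup>\<dagger> o\<^sub>L Q = id_blinfun" and QQ': "Q o\<^sub>L Q\<^sup>\<dagger> = id_blinfun"
    using pd(3) by (auto simp: unitary_op_def)
  have QQx: "(Q\<^sup>\<dagger>) (Q x) = x" for x using arg_cong[OF QQ, of "\<lambda>F. F x"] by simp
  have QQx': "Q ((Q\<^sup>\<dagger>) x) = x" for x using arg_cong[OF QQ', of "\<lambda>F. F x"] by simp
  have Ax: "A x = Q (S x)" for x using arg_cong[OF pd(4), of "\<lambda>F. F x"] by simp
  have Ax': "(A\<^sup>\<dagger>) x = S ((Q\<^sup>\<dagger>) x)" for x using arg_cong[OF pd(5), of "\<lambda>F. F x"] by simp
  have F: "?F x = (1 / sqrt 2) *\<^sub>R (- Q x, x)" for x by (simp add: Q_def)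
  have H: "?H (x, y) = (A y, (A\<^sup>\<dagger>) x)" for x y by (simp add: A_def)
  have linF: "clinear_op ?F" using linQ unfolding Q_def by (rule clinear_negative_frame)
  have HF: "?H (?F x) = - ?F (S x)" for x
    by (simp add: F H Ax Ax' QQx blinfun.scaleR_right blinfun.minus_right
        del: negative_frame_apply hermitization_apply)
  have "?F x \<in> negative_spectral_subspace ?H" for x
  proof -
    obtain bs l where eb: "eigenbasis S bs l" using spectral_theorem[OF pd(1)] .
    then have on: "orthonormal_basis bs" by (simp add: eigenbasis_def)
    have "?F (bs ! i) \<in> {v. \<exists>r<0. ?H v = r *\<^sub>R v}" if i: "i < length bs" for i
    proof -
      have "?H (?F (bs ! i)) = (- l i) *\<^sub>R ?F (bs ! i)"
        using eb i unfolding HF by (simp add: eigenbasis_def blinfun.scaleR_right del: negative_frame_apply)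
      moreover have "m \<le> l i" using coercive_eigenbasis_iff[OF pd(1) eb, of m] pd(2) i by blast
      then have "- l i < 0" using m by simp
      ultimately show ?thesis by blast
    qed
    then have "(\<Sum>i<length bs. cinner (bs ! i) x *\<^sub>C ?F (bs ! i)) \<in> negative_spectral_subspace ?H"
      unfolding negative_spectral_subspace_def
      by (intro complex_vector.span_sum complex_vector.span_scale complex_vector.span_base) simp
    then show ?thesis unfolding clinear_op_apply_expansion[OF linF on, of x] .
  qed
  moreover have "negative_spectral_subspace ?H \<subseteq> range (blinfun_apply ?F)"
    unfolding negative_spectral_subspace_def
  proof (rule complex_vector.span_minimal)
    show "complex_vector.subspace (range (blinfun_apply ?F))"
      unfolding complex_vector.subspace_def
    proof (intro conjI ballI allI)
      show "0 \<in> range (blinfun_apply ?F)" by (rule image_eqI[of _ _ 0]) simp_all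
      fix u assume "u \<in> range (blinfun_apply ?F)"
      then obtain x where u: "u = ?F x" by blast
      show "c *\<^sub>C u \<in> range (blinfun_apply ?F)" for c
        unfolding u clinear_op_scaleC[OF linF, symmetric] by (rule rangeI)
      show "u + v \<in> range (blinfun_apply ?F)" if "v \<in> range (blinfun_apply ?F)" for v
        using that unfolding u by (auto simp: blinfun.add_right[symmetric] simp del: negative_frame_apply)
    qed
    show "{v. \<exists>r<0. ?H v = r *\<^sub>R v} \<subseteq> range (blinfun_apply ?F)"
    proof
      fix v assume "v \<in> {v. \<exists>r<0. ?H v = r *\<^sub>R v}"
      then obtain r where r: "r < 0" and Hv: "?H v = r *\<^sub>R v" by blast
      obtain a b where v: "v = (a, b)" by (cases v)
      define c where "c = (Q\<^sup>\<dagger>) a"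
      have a: "a = Q c" by (simp add: c_def QQx')
      have "A b = r *\<^sub>R a" and Sc: "S c = r *\<^sub>R b" using Hv
        by (simp_all add: v H Ax' c_def del: hermitization_apply)
      then have "(Q\<^sup>\<dagger>) (Q (S b)) = (Q\<^sup>\<dagger>) (r *\<^sub>R Q c)" by (simp add: Ax a)
      then have Sb: "S b = r *\<^sub>R c" by (simp add: QQx blinfun.scaleR_right)
      have "S (b + c) = r *\<^sub>R (b + c)"
        by (simp add: blinfun.add_right Sb Sc scaleR_add_right add.commute)
      then have "b + c = 0"
        using coercive_eigenvalue_ge[OF pd(2), of "b + c" r] r m by auto
      then have "a = - Q b" using a by (simp add: add_eq_0_iff blinfun.minus_right)
      then have "v = ?F (sqrt 2 *\<^sub>R b)" by (simp add: v F blinfun.scaleR_right del: negative_frame_apply)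
      then show "v \<in> range (blinfun_apply ?F)" by blast
    qed
  qed
  ultimately show ?thesis by blast
qed

section \<open>Loops\<close>

lemma periodic_reduce_to_period:
  fixes N :: "real \<Rightarrow> 'a"
  assumes "\<And>t. N (t + 2 * pi) = N t"
  shows "\<exists>s\<in>{0..2*pi}. N s = N t"
proof -
  interpret periodic_fun_simple N "2 * pi" by unfold_locales (rule assms)
  let ?k = "\<lfloor>t / (2 * pi)\<rfloor>"
  have "of_int ?k * (2 * pi) \<le> t" "t \<le> (of_int ?k + 1) * (2 * pi)"
    using floor_divide_lower[of "2 * pi" t] floor_divide_upper[of "2 * pi" t] by simp_all
  then have "t - of_int ?k * (2 * pi) \<in> {0..2*pi}" by (simp add: distrib_right)
  then show ?thesis using minus_of_int[of t ?k] by blast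
qed

lemma loop_deriv_eqI:
  assumes "(G has_vector_derivative D) (at t)" "t \<in> {0..2*pi}" "\<And>s. s \<in> {0..2*pi} \<Longrightarrow> F s = G s"
  shows "loop_deriv F t = D"
  unfolding loop_deriv_def
proof (rule vector_derivative_within_cbox[where a = 0 and b = "2 * pi", unfolded box_real])
  show "(F has_vector_derivative D) (at t within {0..2*pi})"
    by (rule has_vector_derivative_transform[OF assms(2) _ has_vector_derivative_at_within[OF assms(1)]])
      (rule assms(3))
qed (use assms(2) in auto)

lemma C1_periodic_loopI:
  assumes "G C1_differentiable_on UNIV" "\<And>t. G (t + 2*pi) = G t"
    and "\<And>t. t \<in> {0..2*pi} \<Longrightarrow> F t = G t" "\<And>t. t \<in> {0..2*pi} \<Longrightarrow> clinear_op (F t)"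
  shows "C1_periodic_loop F"
  unfolding C1_periodic_loop_def using assms by (intro conjI exI[of _ G]) auto

text \<open>Being affine in the polar unitary, the frame inherits its smoothness, and the derivative of the
  frame is a fixed linear image of that of the polar unitary.\<close>

lemma negative_frame_affine:
  fixes M :: "real \<Rightarrow> 'e::complex_inner \<Rightarrow>\<^sub>L 'e"
  defines "inl \<equiv> Blinfun (\<lambda>x :: 'e. (x, 0 :: 'e))" and "inr \<equiv> Blinfun (\<lambda>x :: 'e. (0 :: 'e, x))"
  shows "negative_frame M z t = (1 / sqrt 2) *\<^sub>R (inr - (inl o\<^sub>L polar_unitary M z t))"
    and "blinfun_apply inl x = (x, 0)"
proof -
  have "bounded_linear (\<lambda>x :: 'e. (x, 0 :: 'e))" "bounded_linear (\<lambda>x :: 'e. (0 :: 'e, x))"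
    by (intro bounded_linear_intros)+
  then have inl: "inl x = (x, 0)" and inr: "inr x = (0, x)" for x
    by (simp_all add: inl_def inr_def bounded_linear_Blinfun_apply)
  then show "blinfun_apply inl x = (x, 0)" by simp
  show "negative_frame M z t = (1 / sqrt 2) *\<^sub>R (inr - (inl o\<^sub>L polar_unitary M z t))"
    by (rule blinfun_eqI) (simp add: blinfun.scaleR_left blinfun.diff_left inl inr)
qed

theorem theorem4p2:
  fixes M :: "real \<Rightarrow> 'e::fin_dim_complex_hilbert \<Rightarrow>\<^sub>L 'e" and z :: complex
  assumes "C1_periodic_loop M"
    and "point_gap M z"
  shows "(\<forall>t\<in>{0..2*pi}. \<forall>U. unitary_polar_factor U (shifted M z t) \<longleftrightarrow> U = polar_unitary M z t)
    \<and> C1_periodic_loop (polar_unitary M z)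
    \<and> (\<exists>m>0. \<forall>t\<in>{0..2*pi}. cspectrum (hermitization M z t) \<inter> complex_of_real ` {-m<..<m} = {})
    \<and> C1_periodic_loop (negative_frame M z)
    \<and> (\<forall>t\<in>{0..2*pi}.
          (negative_frame M z t)\<^sup>\<dagger> o\<^sub>L negative_frame M z t = id_blinfun
        \<and> range (blinfun_apply (negative_frame M z t))
            = negative_spectral_subspace (hermitization M z t))
    \<and> det_winding M z \<in> \<int>
    \<and> 1 / (2 * pi * \<i>) * integral {0..2*pi}
          (\<lambda>t. trace_op ((polar_unitary M z t)\<^sup>\<dagger> o\<^sub>L loop_deriv (polar_unitary M z) t))
        = det_winding M z
    \<and> zak_phase (negative_frame M z) = - pi * det_winding M z
    \<and> (\<exists>k::int. zak_phase (negative_frame M z) = pi * det_winding M z + 2 * pi * k)"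
proof -
  let ?I = "{0..2*pi}"
  \<comment> \<open>Only the values of \<open>M\<close> on one period matter, so all calculus is done on its periodic extension \<open>N\<close>, where no one-sided derivatives occur.\<close>
  obtain N where NC1: "N C1_differentiable_on UNIV" and per: "\<And>t. N (t + 2*pi) = N t"
    and NM: "\<And>t. t \<in> ?I \<Longrightarrow> N t = M t" and linM: "\<And>t. t \<in> ?I \<Longrightarrow> clinear_op (M t)"
    using assms(1) by (auto simp: C1_periodic_loop_def)
  define A where "A = shifted N z"
  have AM: "A t = shifted M z t" if "t \<in> ?I" for t using NM[OF that] by (simp add: A_def shifted_def)
  have Aper: "A (t + 2*pi) = A t" for t by (simp add: A_def shifted_def per)
  have A_cases: "\<exists>s\<in>?I. A t = shifted M z s" for t
    using periodic_reduce_to_period[of A t, OF Aper] AM by metis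
  have linA: "clinear_op (A t)" for t
  proof -
    obtain s where s: "s \<in> ?I" "A t = M s - scalar_op z" using A_cases[of t] by (auto simp: shifted_def)
    show ?thesis unfolding s(2) by (intro clinear_op_diff clinear_op_scalar linM s(1))
  qed
  have invA: "invertible_op (A t)" for t
    using A_cases[of t] assms(2) by (auto simp: point_gap_def)
  have AC1: "A C1_differentiable_on UNIV"
    using NC1 unfolding A_def shifted_def[abs_def] by (intro C1_differentiable_on_diff) simp_all
  have contA: "continuous_on UNIV A" using AC1 by (rule C1_differentiable_imp_continuous_on)
  have injA: "x = 0" if "A t x = 0" for t x
  proof -
    obtain B where "B o\<^sub>L A t = id_blinfun" using invA[of t] by (auto simp: invertible_op_def)
    from arg_cong[OF this, of "\<lambda>F. F x"] show ?thesis using that by simp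
  qed
  obtain m where m: "0 < m" and bdI: "\<And>t. t \<in> ?I \<Longrightarrow> bounded_below (A t) m"
    using uniformly_bounded_below[of 0 "2 * pi" A] continuous_on_subset[OF contA] injA by blast
  have bdA: "bounded_below (A t) m" for t using A_cases[of t] AM bdI by metis

  define Q where "Q t = polar_unitary_op (A t)" for t
  have QM: "polar_unitary M z t = Q t" if "t \<in> ?I" for t
    by (simp add: Q_def polar_unitary_eq AM[OF that])
  note polar = polar_decomposition[OF linA bdA m invA]
  have U: "unitary_op (Q t)" for t unfolding Q_def by (rule polar)
  have linQ: "clinear_op (Q t)" for t using U by (auto simp: unitary_op_def)
  have QC1: "Q C1_differentiable_on UNIV"
    unfolding Q_def[abs_def] by (rule C1_polar_unitary_op[OF AC1 linA bdA m])
  have Qper: "Q (t + 2*pi) = Q t" for t by (simp add: Q_def Aper)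
  obtain Q' where Q': "\<And>t. (Q has_vector_derivative Q' t) (at t)" and contQ': "continuous_on UNIV Q'"
    using QC1 by (auto simp: C1_differentiable_on_def)

  define inl where "inl = Blinfun (\<lambda>x :: 'e. (x, 0 :: 'e))"
  define inr where "inr = Blinfun (\<lambda>x :: 'e. (0 :: 'e, x))"
  define F where "F t = (1 / sqrt 2) *\<^sub>R (inr - (inl o\<^sub>L Q t))" for t
  have FM: "negative_frame M z t = F t" if "t \<in> ?I" for t
    unfolding F_def QM[OF that, symmetric] inl_def inr_def by (rule negative_frame_affine)
  have F': "(F has_vector_derivative (- (1 / sqrt 2)) *\<^sub>R (inl o\<^sub>L Q' t)) (at t)" for t
  proof -
    have "((\<lambda>t. inl o\<^sub>L Q t) has_vector_derivative (inl o\<^sub>L Q' t)) (at t)"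
      by (rule bounded_linear.has_vector_derivative[OF
            bounded_bilinear.bounded_linear_right[OF bounded_bilinear_blinfun_compose] Q'])
    from has_vector_derivative_diff[OF has_vector_derivative_const this]
    have "((\<lambda>t. inr - (inl o\<^sub>L Q t)) has_vector_derivative 0 - (inl o\<^sub>L Q' t)) (at t)" .
    from bounded_linear.has_vector_derivative[OF bounded_linear_scaleR_right this, of "1 / sqrt 2"]
    show ?thesis by (simp add: F_def[abs_def])
  qed
  have "continuous_on UNIV (\<lambda>t. (- (1 / sqrt 2)) *\<^sub>R (inl o\<^sub>L Q' t))"
    by (intro continuous_on_scaleR continuous_on_const contQ'
        bounded_bilinear.continuous_on[OF bounded_bilinear_blinfun_compose])
  then have FC1: "F C1_differentiable_on UNIV"
    unfolding C1_differentiable_on_def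
    by (intro exI[of _ "\<lambda>t. (- (1 / sqrt 2)) *\<^sub>R (inl o\<^sub>L Q' t)"] conjI ballI F')

  have goal1: "unitary_polar_factor V (shifted M z t) \<longleftrightarrow> V = polar_unitary M z t" if "t \<in> ?I" for t V
    using polar(6)[of V t] by (simp add: AM[OF that] polar_unitary_eq)
  have goal2: "C1_periodic_loop (polar_unitary M z)"
    by (rule C1_periodic_loopI[OF QC1 Qper QM]) (simp_all add: QM linQ)
  have goal3: "cspectrum (hermitization M z t) \<inter> complex_of_real ` {-m<..<m} = {}" if "t \<in> ?I" for t
    using linA[of t] bdA[of t] invA[of t] unfolding AM[OF that] by (rule hermitization_spectral_gap[OF _ _ m])
  have goal4: "C1_periodic_loop (negative_frame M z)"
  proof (rule C1_periodic_loopI[OF FC1 _ FM])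
    show "F (t + 2*pi) = F t" for t by (simp add: F_def Qper)
    show "clinear_op (negative_frame M z t)" if "t \<in> ?I" for t
      by (rule clinear_negative_frame) (simp add: QM[OF that] linQ)
  qed
  have goal5: "(negative_frame M z t)\<^sup>\<dagger> o\<^sub>L negative_frame M z t = id_blinfun" if "t \<in> ?I" for t
    by (rule negative_frame_isometry) (simp add: QM[OF that] U)
  have goal6: "range (blinfun_apply (negative_frame M z t))
      = negative_spectral_subspace (hermitization M z t)" if "t \<in> ?I" for t
    using linA[of t] bdA[of t] invA[of t] unfolding AM[OF that] by (rule range_negative_frame[OF _ _ m])

  define p where "p s = det_op (shifted M z (2*pi * s))" for s
  define q where "q s = det_op (Q (2*pi * s))" for s
  have pA: "p s = det_op (A (2*pi * s))" if "s \<in> {0..1}" for s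
    using that by (simp add: p_def AM)
  have "path p"
  proof -
    have "continuous_on {0..1} (\<lambda>s. det_op (A (2*pi * s)))"
      by (intro continuous_on_det_op continuous_on_compose2[OF contA] continuous_intros) auto
    then show ?thesis unfolding path_def by (rule continuous_on_eq) (simp add: pA)
  qed
  \<comment> \<open>\<open>det A = det Q * det S\<close>, and \<open>det S\<close> is the product of the positive eigenvalues of \<open>S\<close>\<close>
  have pq: "\<exists>r>0. p s = complex_of_real r * q s" if "s \<in> {0..1}" for s
  proof -
    let ?t = "2 * pi * s"
    let ?S = "sqrt_op ((A ?t)\<^sup>\<dagger> o\<^sub>L A ?t)"
    obtain bs l where eb: "eigenbasis ?S bs l" using spectral_theorem[OF polar(1)] .
    have "m \<le> l i" if "i < length bs" for i
      using coercive_eigenbasis_iff[OF polar(1) eb, of m] polar(2) that by blast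
    then have "0 < (\<Prod>i<length bs. l i)" using m by (intro prod_pos) force
    moreover have "det_op (A ?t) = q s * det_op ?S"
      unfolding q_def det_op_compose[OF linQ, symmetric] unfolding Q_def using polar(4)[of ?t]
      by (rule arg_cong)
    ultimately show ?thesis
      unfolding pA[OF that] det_op_eigenbasis[OF hermitian_imp_clinear[OF polar(1)] eb]
      by (auto simp: mult.commute)
  qed
  have q0: "q s \<noteq> 0" for s unfolding q_def by (rule det_op_unitary_nonzero[OF U])
  have loop_p: "pathfinish p = pathstart p"
    using Aper[of 0] pA[of 0] pA[of 1] by (simp add: pathfinish_def pathstart_def)
  have loop_q: "pathfinish q = pathstart q"
    using Qper[of 0] by (simp add: pathfinish_def pathstart_def q_def)
  have W: "det_winding M z = winding_number p 0" by (simp add: det_winding_def p_def[abs_def])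
  have "0 \<notin> path_image p" using pq q0 by (force simp: path_image_def)
  then have goal7: "det_winding M z \<in> \<int>"
    unfolding W by (rule integer_winding_number[OF \<open>path p\<close> loop_p])
  note wq = winding_number_det_unitary_loop[OF Q' contQ' U, folded q_def[abs_def]]
  have Weq: "det_winding M z = 1 / (2 * pi * \<i>) * integral ?I (\<lambda>t. trace_op ((Q t)\<^sup>\<dagger> o\<^sub>L Q' t))"
  proof -
    have "winding_number p 0 = winding_number q 0"
      by (rule winding_number_positive_multiple[OF \<open>path p\<close> loop_p wq(1) loop_q]) (rule pq q0, assumption?)+
    then show ?thesis unfolding W wq(2) .
  qed
  have dQ: "loop_deriv (polar_unitary M z) t = Q' t" if "t \<in> ?I" for t
    by (rule loop_deriv_eqI[OF Q' that]) (rule QM)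
  have goal8: "1 / (2 * pi * \<i>) * integral ?I
      (\<lambda>t. trace_op ((polar_unitary M z t)\<^sup>\<dagger> o\<^sub>L loop_deriv (polar_unitary M z) t)) = det_winding M z"
    unfolding Weq
    by (intro arg_cong2[of _ _ _ _ "(*)"] refl integral_cong)
      (simp add: QM dQ)
  have "zak_phase (negative_frame M z)
      = \<i> * integral ?I (\<lambda>t. (1 / 2) *\<^sub>R trace_op ((Q t)\<^sup>\<dagger> o\<^sub>L Q' t))"
    unfolding zak_phase_def
  proof (intro arg_cong2[of _ _ _ _ "(*)"] refl integral_cong)
    fix t assume t: "t \<in> ?I"
    have "clinear_op (polar_unitary M z t)" by (simp add: QM[OF t] linQ)
    note adj = negative_frame_adjoint_apply[OF this, unfolded QM[OF t]]
    have dF: "loop_deriv (negative_frame M z) t = (- (1 / sqrt 2)) *\<^sub>R (inl o\<^sub>L Q' t)"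
      by (rule loop_deriv_eqI[OF F' t]) (rule FM)
    have "(negative_frame M z t)\<^sup>\<dagger> o\<^sub>L loop_deriv (negative_frame M z) t
        = (1 / 2) *\<^sub>R ((Q t)\<^sup>\<dagger> o\<^sub>L Q' t)"
      unfolding dF
    proof (rule blinfun_eqI)
      fix x
      have "inl y = (y, 0)" for y unfolding inl_def by (rule negative_frame_affine)
      then show "((negative_frame M z t)\<^sup>\<dagger> o\<^sub>L (- (1 / sqrt 2)) *\<^sub>R (inl o\<^sub>L Q' t)) x
          = ((1 / 2) *\<^sub>R ((Q t)\<^sup>\<dagger> o\<^sub>L Q' t)) x"
        by (simp add: blinfun.scaleR_left blinfun.scaleR_right blinfun.minus_left blinfun.minus_right adj)
    qed
    then show "trace_op ((negative_frame M z t)\<^sup>\<dagger> o\<^sub>L loop_deriv (negative_frame M z) t)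
        = (1 / 2) *\<^sub>R trace_op ((Q t)\<^sup>\<dagger> o\<^sub>L Q' t)"
      by (simp add: linear_simps(5)[OF bounded_linear_trace_op])
  qed
  also have "\<dots> = \<i> * ((1 / 2) *\<^sub>R integral ?I (\<lambda>t. trace_op ((Q t)\<^sup>\<dagger> o\<^sub>L Q' t)))"
    by (simp only: integral_cmul)
  also have "\<dots> = - pi * det_winding M z"
    unfolding Weq by (simp add: scaleR_conv_of_real field_simps)
  finally have goal9: "zak_phase (negative_frame M z) = - pi * det_winding M z" .
  obtain w :: int where w: "det_winding M z = of_int w" using goal7 by (auto elim: Ints_cases)
  have goal10: "\<exists>k::int. zak_phase (negative_frame M z) = pi * det_winding M z + 2 * pi * k"
    by (rule exI[of _ "- w"]) (simp add: goal9 w)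
  show ?thesis
    using goal1 goal2 goal3 goal4 goal5 goal6 goal7 goal8 goal9 goal10 m by blast
qed

end
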